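(* Let $d\ge 1$, let $S$ be a Borel subset of $\mathbb{R}^d$ and let $\sigma$ be a (positive) measure on Borel subsets of $S$. Let $p\in[1,2]$ and $q\in(1,\infty)$ be such that $p<q$, let $\varrho\in(p,\infty)$, and let $\eta\in(0,\infty)$. Let $\mu$ be a complex measure on Borel subsets of $\mathbb{R}^d$ whose Fourier transform $\widehat{\mu}$ is a $\mathrm{C}^\infty$ function satisfying $$|\nabla\widehat{\mu}(x)| \leq D (1+|x|)^{-1-\eta}\quad\text{for each } x\in\mathbb{R}^d$$ with a constant $D\in[0,\infty)$. Suppose that there is a constant $C_{\mathrm{restr}}\in[0,\infty)$ such that $$\big\|\widehat{f}\,\big\|_{L^q(S,\sigma)} \leq C_{\mathrm{restr}} \|f\|_{L^p(\mathbb{R}^d)}$$ holds for every Schwartz function $f$ on $\mathbb{R}^d$. Then $$\bigg\| \sup_{\substack{m\in\mathbb{N}\\ 0<t_0<t_1<\cdots<t_m}} \Big( \sum_{j=1}^{m} \big| \widehat{f}\ast\mu_{t_{j}} - \widehat{f}\ast\mu_{t_{j-1}} \big|^{\varrho} \Big)^{1/\varrho} \bigg\|_{L^q(S,\sigma)} \leq A\, C_{\mathrm{restr}} D \|f\|_{L^p(\mathbb{R}^d)}$$ for every Schwartz function $f$ on $\mathbb{R}^d$, where $A\in[0,\infty)$ is a constant depending only on $p,q,\varrho,\eta$.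
   Context: $\mathbb{N}$ is the set of positive integers. A complex measure is finite by definition. Schwartz functions are complex-valued. For an integrable function $f$ on $\mathbb{R}^d$, $\widehat{f}(y)=\int_{\mathbb{R}^d}e^{-2\pi i x\cdot y}f(x)\,dx$, and for a complex Borel measure $\mu$, $\widehat{\mu}(y)=\int_{\mathbb{R}^d}e^{-2\pi i x\cdot y}\,d\mu(x)$. For $t\in(0,\infty)$, $\mu_t$ is the complex measure $\mu_t(E):=\mu(t^{-1}E)$ for Borel sets $E\subseteq\mathbb{R}^d$. Convolution: $(g\ast\mu)(x)=\int_{\mathbb{R}^d}g(x-y)\,d\mu(y)$. $|x|$ is the Euclidean length. In $L^q(S,\sigma)$-norms, functions on $\mathbb{R}^d$ are restricted to $S$; the supremum is taken pointwise. *)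

theory Defs
  imports "HOL-Analysis.Analysis"
begin

text \<open>
  The dimension has to be an ordinary natural number, quantified after the constant whose
  independence of the dimension is claimed. Hence the points of \<open>d\<close>-dimensional Euclidean space are
  the functions \<open>nat \<Rightarrow> real\<close> that are \<open>undefined\<close> outside \<open>{..<d}\<close>, i.e. the space of the product
  measure below. The sets of that measure are the Borel sets, the measure itself is Lebesgue measure,
  and the topology inherited from the function type (the product topology) is the Euclidean one.
\<close>

definition Rn :: "nat \<Rightarrow> (nat \<Rightarrow> real) set" where
  "Rn d = ({..<d} \<rightarrow>\<^sub>E UNIV)"

definition lebn :: "nat \<Rightarrow> (nat \<Rightarrow> real) measure" where
  "lebn d = PiM {..<d} (\<lambda>_. lborel)"

definition dotn :: "nat \<Rightarrow> (nat \<Rightarrow> real) \<Rightarrow> (nat \<Rightarrow> real) \<Rightarrow> real" where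
  "dotn d x y = (\<Sum>i<d. x i * y i)"

definition normn :: "nat \<Rightarrow> (nat \<Rightarrow> real) \<Rightarrow> real" where
  "normn d x = L2_set x {..<d}"

definition minusn :: "nat \<Rightarrow> (nat \<Rightarrow> real) \<Rightarrow> (nat \<Rightarrow> real) \<Rightarrow> nat \<Rightarrow> real" where
  "minusn d x y = (\<lambda>i\<in>{..<d}. x i - y i)"

definition scalen :: "nat \<Rightarrow> real \<Rightarrow> (nat \<Rightarrow> real) \<Rightarrow> nat \<Rightarrow> real" where
  "scalen d t x = (\<lambda>i\<in>{..<d}. t * x i)"

definition pdiff :: "nat \<Rightarrow> ((nat \<Rightarrow> real) \<Rightarrow> complex) \<Rightarrow> (nat \<Rightarrow> real) \<Rightarrow> complex" where
  "pdiff i g x = vector_derivative (\<lambda>s. g (x(i := s))) (at (x i))"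

text \<open>All iterated partial derivatives, of every order and in every sequence of coordinates,
  exist and are continuous.\<close>

definition smoothn :: "nat \<Rightarrow> ((nat \<Rightarrow> real) \<Rightarrow> complex) \<Rightarrow> bool" where
  "smoothn d g \<longleftrightarrow> (\<forall>js. set js \<subseteq> {..<d} \<longrightarrow>
     continuous_on (Rn d) (foldr pdiff js g) \<and>
     (\<forall>i<d. \<forall>x\<in>Rn d. (\<lambda>s. foldr pdiff js g (x(i := s))) differentiable (at (x i))))"

definition schwartz :: "nat \<Rightarrow> ((nat \<Rightarrow> real) \<Rightarrow> complex) \<Rightarrow> bool" where
  "schwartz d f \<longleftrightarrow> smoothn d f \<and>
     (\<forall>js. set js \<subseteq> {..<d} \<longrightarrow>
       (\<forall>N::nat. \<exists>B. \<forall>x\<in>Rn d. (1 + normn d x) ^ N * norm (foldr pdiff js f x) \<le> B))"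

definition grad_norm :: "nat \<Rightarrow> ((nat \<Rightarrow> real) \<Rightarrow> complex) \<Rightarrow> (nat \<Rightarrow> real) \<Rightarrow> real" where
  "grad_norm d g x = L2_set (\<lambda>i. norm (pdiff i g x)) {..<d}"

definition fourier :: "nat \<Rightarrow> ((nat \<Rightarrow> real) \<Rightarrow> complex) \<Rightarrow> (nat \<Rightarrow> real) \<Rightarrow> complex" where
  "fourier d f y = (LINT x|lebn d. exp (- 2 * of_real pi * \<i> * of_real (dotn d x y)) * f x)"

definition complex_measure :: "'a measure \<Rightarrow> ('a set \<Rightarrow> complex) \<Rightarrow> bool" where
  "complex_measure M \<mu> \<longleftrightarrow> \<mu> {} = 0 \<and>
     (\<forall>E :: nat \<Rightarrow> 'a set. range E \<subseteq> sets M \<longrightarrow> disjoint_family E \<longrightarrow>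
        (\<lambda>n. \<mu> (E n)) sums \<mu> (\<Union>n. E n))"

text \<open>The positive part in the Jordan decomposition of a signed measure \<open>\<nu>\<close> on the \<open>\<sigma>\<close>-algebra of
  \<open>M\<close>; the negative part is the positive part of \<open>- \<nu>\<close>. The truncation of negative values by
  \<open>ennreal\<close> is harmless, since the empty set always competes in the supremum.\<close>

definition jordan_pos :: "'a measure \<Rightarrow> ('a set \<Rightarrow> real) \<Rightarrow> 'a measure" where
  "jordan_pos M \<nu> = measure_of (space M) (sets M)
     (\<lambda>E. SUP F\<in>{F \<in> sets M. F \<subseteq> E}. ennreal (\<nu> F))"

definition cm_integral :: "'a measure \<Rightarrow> ('a set \<Rightarrow> complex) \<Rightarrow> ('a \<Rightarrow> complex) \<Rightarrow> complex" where
  "cm_integral M \<mu> g =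
     ((LINT x|jordan_pos M (\<lambda>E. Re (\<mu> E)). g x) - (LINT x|jordan_pos M (\<lambda>E. - Re (\<mu> E)). g x)) +
     \<i> * ((LINT x|jordan_pos M (\<lambda>E. Im (\<mu> E)). g x) - (LINT x|jordan_pos M (\<lambda>E. - Im (\<mu> E)). g x))"

definition cm_fourier :: "nat \<Rightarrow> ((nat \<Rightarrow> real) set \<Rightarrow> complex) \<Rightarrow> (nat \<Rightarrow> real) \<Rightarrow> complex" where
  "cm_fourier d \<mu> y =
     cm_integral (lebn d) \<mu> (\<lambda>x. exp (- 2 * of_real pi * \<i> * of_real (dotn d x y)))"

definition dilate ::
    "nat \<Rightarrow> real \<Rightarrow> ((nat \<Rightarrow> real) set \<Rightarrow> complex) \<Rightarrow> (nat \<Rightarrow> real) set \<Rightarrow> complex" where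
  "dilate d t \<mu> E = \<mu> (scalen d (inverse t) ` E)"

definition conv ::
    "nat \<Rightarrow> ((nat \<Rightarrow> real) \<Rightarrow> complex) \<Rightarrow> ((nat \<Rightarrow> real) set \<Rightarrow> complex) \<Rightarrow> (nat \<Rightarrow> real) \<Rightarrow> complex" where
  "conv d g \<mu> x = cm_integral (lebn d) \<mu> (\<lambda>y. g (minusn d x y))"

text \<open>Real powers of extended nonnegative numbers, used with exponent \<open>a > 0\<close> only.\<close>

definition epowr :: "ennreal \<Rightarrow> real \<Rightarrow> ennreal" where
  "epowr u a = (if u = top then top else ennreal (enn2real u powr a))"

definition Lnorm :: "real \<Rightarrow> 'a measure \<Rightarrow> ('a \<Rightarrow> ennreal) \<Rightarrow> ennreal" where
  "Lnorm q M F = epowr (\<integral>\<^sup>+x. epowr (F x) q \<partial>M) (1 / q)"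

definition variation ::
    "nat \<Rightarrow> real \<Rightarrow> ((nat \<Rightarrow> real) set \<Rightarrow> complex) \<Rightarrow> ((nat \<Rightarrow> real) \<Rightarrow> complex) \<Rightarrow> (nat \<Rightarrow> real) \<Rightarrow> ennreal"
  where
  "variation d \<rho> \<mu> g x =
     (SUP (m, t) \<in> {(m :: nat, t :: nat \<Rightarrow> real). 1 \<le> m \<and> 0 < t 0 \<and> (\<forall>j<m. t j < t (Suc j))}.
        ennreal ((\<Sum>j=1..m. norm (conv d g (dilate d (t j) \<mu>) x
                                - conv d g (dilate d (t (j - 1)) \<mu>) x) powr \<rho>) powr (1 / \<rho>)))"

end

theory Submission
  imports Defs "HOL-Probability.Sinc_Integral"
begin

text \<open>
  Write \<open>g\<close> for the Fourier transform of the Schwartz function \<open>f\<close> and \<open>m t z\<close> for the value of the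
  Fourier transform of \<open>\<mu>\<close> at \<open>- t z\<close>. By Fubini, the convolution of \<open>g\<close> with \<open>\<mu>\<^sub>t\<close> is the Fourier
  transform \<open>F t\<close> of \<open>f * m t\<close> (lemma \<open>conv_fourier_dilate\<close>). So every difference of two averages is again
  a Fourier transform, to which the restriction estimate applies, and the theorem becomes a
  statement about the path \<open>t \<mapsto> F t\<close> in \<open>L\<^sup>q(\<sigma>)\<close>.

  The gradient bound says that along each ray the multiplier moves no faster than a scalar
  increasing function: for \<open>s \<le> t\<close>,
  \<open>\<bar>m t z - m s z\<bar> \<le> (D / \<eta>) (a t z - a s z)\<close> with \<open>a t z = 1 - (1 + t\<bar>z\<bar>) powr (-\<eta>) \<in> [0, 1]\<close>
  (lemma \<open>radial_increment_le\<close>). Because \<open>(b - a)\<^sup>p \<le> b\<^sup>p - a\<^sup>p\<close> for \<open>p \<ge> 1\<close>, this gives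
  \<open>\<parallel>F t - F s\<parallel>\<^sub>q \<le> C (D / \<eta>) (\<Lambda> t - \<Lambda> s) powr (1/p)\<close> for the increasing function
  \<open>\<Lambda> t = \<integral> \<bar>f\<bar>\<^sup>p (a t)\<^sup>p\<close>, whose values are at most \<open>\<parallel>f\<parallel>\<^sub>p\<^sup>p\<close>. After the change of variable
  \<open>u = \<Lambda> t\<close> the path is Hoelder continuous of order \<open>1/p\<close> with values in \<open>L\<^sup>q(\<sigma>)\<close>.

  Such a path has finite \<open>r\<close>-variation for every \<open>r > p\<close>, in the strong sense that one function in
  \<open>L\<^sup>q\<close> bounds the variation over all partitions. This is the dyadic argument of Christ and Kiselev:
  an interval is a union of dyadic intervals, at most two of each length, so the variation is
  controlled by the increments over dyadic intervals; there are \<open>2\<^sup>n\<close> of length \<open>2\<^sup>-\<^sup>n\<close>, each with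
  norm at most \<open>2 powr (-n/p)\<close>, and \<open>2 powr (n/r - n/p)\<close> is summable (lemmas
  \<open>continuous_variation_bound\<close> and \<open>variation_bound_of_increments\<close>). Any \<open>r\<close> strictly between \<open>p\<close> and
  \<open>min q \<rho>\<close> will do, because the \<open>\<rho>\<close>-variation is at most the \<open>r\<close>-variation.

  One point needs care: \<open>f * m t\<close> is smooth and integrable but need not be a Schwartz function, since
  nothing is known about the size of the higher derivatives of \<open>m t\<close>. Multiplying by smooth cutoffs
  and applying Fatou's lemma extends the restriction estimate to it (lemma
  \<open>restriction_estimate_extends\<close>).
\<close>

section \<open>Variation of a path controlled by its dyadic increments\<close>
definition dyadic_cells :: "nat \<Rightarrow> real \<Rightarrow> real \<Rightarrow> nat set" where
  "dyadic_cells n a b = {k. a \<le> real k / 2 ^ n \<and> real (Suc k) / 2 ^ n \<le> b}"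

definition dyadic_energy ::
    "real \<Rightarrow> (real \<Rightarrow> 'a::real_normed_vector) \<Rightarrow> nat \<Rightarrow> real \<Rightarrow> real \<Rightarrow> real" where
  "dyadic_energy r g n a b =
     (\<Sum>k\<in>dyadic_cells n a b. norm (g (real (Suc k) / 2 ^ n) - g (real k / 2 ^ n)) powr r)"

lemma finite_dyadic_cells [simp]: "finite (dyadic_cells n a b)"
proof (rule finite_subset)
  show "dyadic_cells n a b \<subseteq> {..nat \<lceil>b * 2 ^ n\<rceil>}"
  proof
    fix k assume "k \<in> dyadic_cells n a b"
    then have "real k \<le> b * 2 ^ n"
      by (auto simp: dyadic_cells_def field_simps)
    then show "k \<in> {..nat \<lceil>b * 2 ^ n\<rceil>}" by (simp add: le_nat_iff) linarith
  qed
qed simp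

lemma dyadic_energy_nonneg: "0 \<le> dyadic_energy r g n a b"
  by (simp add: dyadic_energy_def sum_nonneg)

lemma dyadic_energy_mono:
  assumes "a \<le> a'" "b' \<le> b"
  shows "dyadic_energy r g n a' b' \<le> dyadic_energy r g n a b"
  unfolding dyadic_energy_def
proof (rule sum_mono2)
  show "dyadic_cells n a' b' \<subseteq> dyadic_cells n a b"
    using assms by (auto simp: dyadic_cells_def)
qed auto

lemma dyadic_energy_superadditive:
  assumes "a \<le> b" "b \<le> c"
  shows "dyadic_energy r g n a b + dyadic_energy r g n b c \<le> dyadic_energy r g n a c"
proof -
  have disj: "dyadic_cells n a b \<inter> dyadic_cells n b c = {}"
  proof -
    have "\<not> (real (Suc k) / 2 ^ n \<le> b \<and> b \<le> real k / 2 ^ n)" for k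
    proof
      assume "real (Suc k) / 2 ^ n \<le> b \<and> b \<le> real k / 2 ^ n"
      then have "real (Suc k) / 2 ^ n \<le> real k / 2 ^ n" by linarith
      then have "real (Suc k) \<le> real k" by (subst (asm) divide_le_cancel) auto
      then show False by simp
    qed
    then show ?thesis by (auto simp: dyadic_cells_def)
  qed
  show ?thesis
    unfolding dyadic_energy_def sum.union_disjoint [OF finite_dyadic_cells finite_dyadic_cells disj, symmetric]
  proof (rule sum_mono2)
    show "dyadic_cells n a b \<union> dyadic_cells n b c \<subseteq> dyadic_cells n a c"
      using assms by (auto simp: dyadic_cells_def)
  qed auto
qed

lemma dyadic_energy_sum_le:
  assumes "\<And>j. j < m \<Longrightarrow> s j \<le> s (Suc j)"
  shows "(\<Sum>j = 1..m. dyadic_energy r g n (s (j - 1)) (s j)) \<le> dyadic_energy r g n (s 0) (s m) \<and> s 0 \<le> s m"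
  using assms
proof (induction m)
  case 0
  then show ?case by (simp add: dyadic_energy_nonneg)
next
  case (Suc m)
  then show ?case
    using dyadic_energy_superadditive [of "s 0" "s m" "s (Suc m)" r g n]
    by (force dest: less_SucI)
qed

lemma dyadic_increment_le:
  assumes "k \<in> dyadic_cells n a b" "0 < r"
  shows "norm (g (real (Suc k) / 2 ^ n) - g (real k / 2 ^ n)) \<le> dyadic_energy r g n a b powr (1 / r)"
proof -
  let ?x = "norm (g (real (Suc k) / 2 ^ n) - g (real k / 2 ^ n))"
  have "?x powr r \<le> dyadic_energy r g n a b"
    unfolding dyadic_energy_def
    by (rule member_le_sum [OF assms(1), of "\<lambda>k. norm (g (real (Suc k) / 2 ^ n) - g (real k / 2 ^ n)) powr r"]) auto
  then have "(?x powr r) powr (1 / r) \<le> dyadic_energy r g n a b powr (1 / r)"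
    using assms(2) by (intro powr_mono2) auto
  then show ?thesis using assms(2) by (simp add: powr_powr)
qed

text \<open>
  Rounding \<open>u\<close> up and \<open>v\<close> down to even numbers costs at most one dyadic interval of the finest length at
  each end, and leaves the same problem one level coarser. Hence every level contributes at most
  two intervals, all of them inside the interval from \<open>u\<close> to \<open>v\<close>; an increment over one of them is at
  most the \<open>\<ell>\<^sup>r\<close> norm of all increments of its level inside the interval. Keeping the localisation to
  this interval is what later allows summation over the intervals of a partition.
\<close>

lemma dyadic_chaining:
  fixes u v N :: nat
  assumes "0 < r" "u \<le> v" "v < 2 ^ N"
  shows "norm (g (real v / 2 ^ N) - g (real u / 2 ^ N))
    \<le> 2 * (\<Sum>n\<le>N. dyadic_energy r g n (real u / 2 ^ N) (real v / 2 ^ N) powr (1 / r))"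
  using assms(2,3)
proof (induction N arbitrary: u v)
  case 0
  then show ?case by (simp add: sum_nonneg)
next
  case (Suc N)
  let ?S = "Suc N"
  let ?a = "real u / 2 ^ ?S" and ?b = "real v / 2 ^ ?S"
  let ?e = "dyadic_energy r g ?S ?a ?b powr (1 / r)"
  define u' where "u' = (u + 1) div 2"
  define v' where "v' = v div 2"
  have half: "real k / 2 ^ N = real (2 * k) / 2 ^ ?S" for k by simp
  show ?case
  proof (cases "u' \<le> v'")
    case True
    have v': "v' < 2 ^ N" using Suc.prems by (simp add: v'_def)
    have uu: "u \<le> 2 * u'" and vv: "2 * v' \<le> v" by (auto simp: u'_def v'_def)
    have bd: "?a \<le> real u' / 2 ^ N" "real v' / 2 ^ N \<le> ?b"
      unfolding half using uu vv by (auto intro!: divide_right_mono simp del: of_nat_mult)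
    have left: "norm (g (real u' / 2 ^ N) - g ?a) \<le> ?e"
    proof (cases "2 * u' = u")
      case True
      then show ?thesis by (subst half) simp
    next
      case False
      then have eq: "2 * u' = Suc u" by (auto simp: u'_def)
      have "2 * u' \<le> v" using \<open>u' \<le> v'\<close> vv by linarith
      then have "Suc u \<le> v" using eq by simp
      then have "u \<in> dyadic_cells ?S ?a ?b"
        unfolding dyadic_cells_def mem_Collect_eq
        by (auto intro!: divide_right_mono simp del: power_Suc of_nat_Suc)
      from dyadic_increment_le [OF this \<open>0 < r\<close>] show ?thesis unfolding half eq .
    qed
    have right: "norm (g ?b - g (real v' / 2 ^ N)) \<le> ?e"
    proof (cases "2 * v' = v")
      case True
      then show ?thesis by (subst half) simp
    next
      case False
      then have eq: "v = Suc (2 * v')" by (auto simp: v'_def)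
      have "u \<le> 2 * v'" using \<open>u' \<le> v'\<close> uu by linarith
      then have "2 * v' \<in> dyadic_cells ?S ?a ?b"
        unfolding dyadic_cells_def mem_Collect_eq eq
        by (auto intro!: divide_right_mono simp del: power_Suc of_nat_Suc of_nat_mult)
      from dyadic_increment_le [OF this \<open>0 < r\<close>] show ?thesis
        unfolding half eq [symmetric] .
    qed
    have "norm (g (real v' / 2 ^ N) - g (real u' / 2 ^ N))
        \<le> 2 * (\<Sum>n\<le>N. dyadic_energy r g n (real u' / 2 ^ N) (real v' / 2 ^ N) powr (1 / r))"
      by (rule Suc.IH [OF True v'])
    also have "\<dots> \<le> 2 * (\<Sum>n\<le>N. dyadic_energy r g n ?a ?b powr (1 / r))"
      using bd \<open>0 < r\<close>
      by (intro mult_left_mono sum_mono powr_mono2 dyadic_energy_mono dyadic_energy_nonneg) auto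
    finally have middle: "norm (g (real v' / 2 ^ N) - g (real u' / 2 ^ N)) \<le> \<dots>" .
    have "norm (g ?b - g ?a) = norm ((g ?b - g (real v' / 2 ^ N))
        + (g (real v' / 2 ^ N) - g (real u' / 2 ^ N)) + (g (real u' / 2 ^ N) - g ?a))" by simp
    also have "\<dots> \<le> ?e + 2 * (\<Sum>n\<le>N. dyadic_energy r g n ?a ?b powr (1 / r)) + ?e"
      by (intro order_trans [OF norm_triangle_ineq] add_mono left right middle)
    finally show ?thesis by simp
  next
    case False
    then have "u = v" using Suc.prems by (auto simp: u'_def v'_def)
    then show ?thesis by (simp add: sum_nonneg)
  qed
qed

text \<open>
  This replaces the triangle inequality in \<open>\<ell>\<^sup>r\<close>. The sum over levels of \<open>\<ell>\<^sup>r\<close> norms is traded for one sum of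
  \<open>r\<close>-th powers, at the price of weights growing like \<open>s\<^sup>-\<^sup>n\<close>, which an exponential decay of the
  \<open>x n\<close> can absorb.
\<close>

lemma sum_le_powr_sum_weighted:
  fixes x :: "nat \<Rightarrow> real"
  assumes "0 < r" "0 < s" "s < 1" "\<And>n. 0 \<le> x n"
  shows "(\<Sum>n\<le>N. x n powr (1 / r)) \<le> (\<Sum>n\<le>N. x n / s ^ n) powr (1 / r) / (1 - s powr (1 / r))"
proof -
  \<comment> \<open>Each term is at most \<open>X powr (1 / r) * \<theta> ^ n\<close>, which leaves a geometric series.\<close>
  define \<theta> where "\<theta> = s powr (1 / r)"
  define X where "X = (\<Sum>n\<le>N. x n / s ^ n)"
  have \<theta>: "0 < \<theta>" "\<theta> < 1"
    using assms powr_less_mono2 [of "1 / r" s 1] by (auto simp: \<theta>_def)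
  have "x n powr (1 / r) \<le> X powr (1 / r) * \<theta> ^ n" if "n \<le> N" for n
  proof -
    have "x n / s ^ n \<le> X"
      unfolding X_def
      by (rule member_le_sum [of n "{..N}" "\<lambda>n. x n / s ^ n"]) (use that assms in auto)
    then have "x n \<le> X * s ^ n" using assms(2) by (simp add: field_simps)
    then have "x n powr (1 / r) \<le> (X * s ^ n) powr (1 / r)"
      using assms by (intro powr_mono2) auto
    also have "\<dots> = X powr (1 / r) * \<theta> ^ n"
      using assms \<theta> by (simp add: powr_mult \<theta>_def sum_nonneg X_def flip: powr_realpow)
        (simp add: powr_powr mult.commute)
    finally show ?thesis .
  qed
  then have "(\<Sum>n\<le>N. x n powr (1 / r)) \<le> (\<Sum>n\<le>N. X powr (1 / r) * \<theta> ^ n)"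
    by (intro sum_mono) auto
  also have "\<dots> = X powr (1 / r) * (\<Sum>n\<le>N. \<theta> ^ n)" by (simp add: sum_distrib_left)
  also have "(\<Sum>n\<le>N. \<theta> ^ n) \<le> 1 / (1 - \<theta>)"
    using \<theta> sum_le_suminf [of "\<lambda>n. \<theta> ^ n" "{..N}"] by (simp add: suminf_geometric)
  finally show ?thesis
    by (simp add: X_def \<theta>_def mult_left_mono)
qed

text \<open>
  The factor \<open>2\<close> counts the two intervals of each level in \<open>dyadic_chaining\<close>; the two geometric series
  come from the weights and from the decay of the energies.
\<close>

definition chaining_const :: "real \<Rightarrow> real \<Rightarrow> real" where
  "chaining_const r s = (2 / (1 - s powr (1 / r))) powr r / (1 - s)"

lemma chaining_const_nonneg: "s < 1 \<Longrightarrow> 0 \<le> chaining_const r s"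
  by (simp add: chaining_const_def)

text \<open>
  Each increment of the partition is chained through dyadic intervals inside its own interval. These
  families are disjoint for different \<open>j\<close>, so the energies of one level add up to at most the total
  energy of that level. The assumed decay \<open>(s\<^sup>2)\<^sup>n\<close> is split evenly: one factor \<open>s\<^sup>n\<close> pays for the weights,
  the other one makes the sum over \<open>n\<close> converge.
\<close>

lemma dyadic_variation_bound:
  fixes u :: "nat \<Rightarrow> nat"
  assumes r: "0 < r" and s: "0 < s" "s < 1"
    and u: "\<And>j. j < m \<Longrightarrow> u j \<le> u (Suc j)" "u m < 2 ^ N"
    and E: "\<And>n. (\<Sum>k | Suc k < 2 ^ n. norm (g (real (Suc k) / 2 ^ n) - g (real k / 2 ^ n)) powr r)
              \<le> (s\<^sup>2) ^ n * H"
  shows "(\<Sum>j = 1..m. norm (g (real (u j) / 2 ^ N) - g (real (u (j - 1)) / 2 ^ N)) powr r)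
    \<le> chaining_const r s * H"
proof -
  define a where "a j = real (u j) / 2 ^ N" for j
  define e where "e n j = dyadic_energy r g n (a (j - 1)) (a j)" for n j
  let ?t = "1 - s powr (1 / r)"
  have t: "0 < ?t" using powr_less_mono2 [of "1 / r" s 1] r s by simp
  have am: "a j \<le> a (Suc j)" if "j < m" for j
    using u(1) [OF that] by (simp add: a_def divide_right_mono)
  have "u j \<le> u m" if "j \<le> m" for j
    using that u(1) by (induction rule: inc_induct) (auto intro: order_trans)
  then have uN: "u j < 2 ^ N" if "j \<le> m" for j
    using u(2) that by (meson le_less_trans)
  have H: "0 \<le> H" using E [of 0] by simp
  have esum: "(\<Sum>j = 1..m. e n j) \<le> (s\<^sup>2) ^ n * H" for n
  proof -
    have "(\<Sum>j = 1..m. e n j) \<le> dyadic_energy r g n (a 0) (a m)"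
      unfolding e_def using dyadic_energy_sum_le [of m a] am by blast
    also have "\<dots> \<le> (\<Sum>k | Suc k < 2 ^ n. norm (g (real (Suc k) / 2 ^ n) - g (real k / 2 ^ n)) powr r)"
      unfolding dyadic_energy_def
    proof (rule sum_mono2)
      have "{k. Suc k < 2 ^ n} \<subseteq> {..<2 ^ n}" by auto
      then show "finite {k. Suc k < (2::nat) ^ n}" by (rule finite_subset) simp
      have "real (u m) < 2 ^ N" using u(2) by (metis of_nat_less_iff of_nat_numeral of_nat_power)
      then have am1: "a m < 1" by (simp add: a_def)
      show "dyadic_cells n (a 0) (a m) \<subseteq> {k. Suc k < 2 ^ n}"
      proof
        fix k assume "k \<in> dyadic_cells n (a 0) (a m)"
        then have "real (Suc k) / 2 ^ n < 1" using am1 unfolding dyadic_cells_def mem_Collect_eq by linarith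
        then have "real (Suc k) < real (2 ^ n)" by simp
        then show "k \<in> {k. Suc k < 2 ^ n}" by (simp only: of_nat_less_iff mem_Collect_eq)
      qed
    qed simp
    finally show ?thesis using E [of n] by linarith
  qed
  have "norm (g (a j) - g (a (j - 1))) powr r \<le> (2 / ?t) powr r * (\<Sum>n\<le>N. e n j / s ^ n)"
    if j: "j \<in> {1..m}" for j
  proof -
    have "norm (g (a j) - g (a (j - 1))) \<le> 2 * (\<Sum>n\<le>N. e n j powr (1 / r))"
      unfolding a_def e_def
      by (rule dyadic_chaining [OF r]) (use j u(1) [of "j - 1"] uN in auto)
    also have "\<dots> \<le> 2 * ((\<Sum>n\<le>N. e n j / s ^ n) powr (1 / r) / ?t)"
      by (intro mult_left_mono sum_le_powr_sum_weighted) (auto simp: e_def dyadic_energy_nonneg r s)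
    finally have "norm (g (a j) - g (a (j - 1))) powr r
        \<le> (2 * ((\<Sum>n\<le>N. e n j / s ^ n) powr (1 / r) / ?t)) powr r"
      using r by (intro powr_mono2) auto
    also have "\<dots> = (2 / ?t * (\<Sum>n\<le>N. e n j / s ^ n) powr (1 / r)) powr r" by simp
    also have "\<dots> = (2 / ?t) powr r * (\<Sum>n\<le>N. e n j / s ^ n)"
    proof -
      have "0 \<le> (\<Sum>n\<le>N. e n j / s ^ n)"
        using s by (auto simp: e_def dyadic_energy_nonneg intro!: sum_nonneg divide_nonneg_pos)
      then have "((\<Sum>n\<le>N. e n j / s ^ n) powr (1 / r)) powr r = (\<Sum>n\<le>N. e n j / s ^ n)"
        unfolding powr_powr using r by simp
      then show ?thesis unfolding powr_mult by (simp only:)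
    qed
    finally show ?thesis .
  qed
  then have "(\<Sum>j = 1..m. norm (g (a j) - g (a (j - 1))) powr r)
      \<le> (\<Sum>j = 1..m. (2 / ?t) powr r * (\<Sum>n\<le>N. e n j / s ^ n))"
    by (rule sum_mono)
  also have "\<dots> = (2 / ?t) powr r * (\<Sum>n\<le>N. (\<Sum>j = 1..m. e n j) / s ^ n)"
    by (simp add: sum_distrib_left sum_divide_distrib) (rule sum.swap)
  also have "(\<Sum>n\<le>N. (\<Sum>j = 1..m. e n j) / s ^ n) \<le> (\<Sum>n\<le>N. s ^ n * H)"
  proof (rule sum_mono)
    fix n
    have "(\<Sum>j = 1..m. e n j) / s ^ n \<le> (s\<^sup>2) ^ n * H / s ^ n"
      using esum s by (intro divide_right_mono) auto
    also have "\<dots> = s ^ n * H"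
      using s by (simp add: power2_eq_square power_mult_distrib)
    finally show "(\<Sum>j = 1..m. e n j) / s ^ n \<le> s ^ n * H" .
  qed
  also have "(\<Sum>n\<le>N. s ^ n * H) = (\<Sum>n\<le>N. s ^ n) * H" by (simp add: sum_distrib_right)
  also have "(\<Sum>n\<le>N. s ^ n) * H \<le> 1 / (1 - s) * H"
    using s sum_le_suminf [of "\<lambda>n. s ^ n" "{..N}"] H
    by (intro mult_right_mono) (simp_all add: suminf_geometric)
  finally show ?thesis
    by (simp add: a_def chaining_const_def mult_left_mono)
qed

text \<open>
  The bound for dyadic partition points does not depend on the level \<open>N\<close>, so rounding arbitrary points
  down to multiples of \<open>2\<^sup>-\<^sup>N\<close> and letting \<open>N\<close> tend to infinity proves it for all partitions. Points are
  rounded down in order to stay in the half-open interval on which \<open>g\<close> is given.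
\<close>

lemma continuous_variation_bound:
  fixes g :: "real \<Rightarrow> 'a::real_normed_vector"
  assumes r: "0 < r" and s: "0 < s" "s < 1"
    and cont: "continuous_on {0..<1} g"
    and a: "0 \<le> a 0" "\<And>j. j < m \<Longrightarrow> a j \<le> a (Suc j)" "a m < 1"
    and E: "\<And>n. (\<Sum>k | Suc k < 2 ^ n. norm (g (real (Suc k) / 2 ^ n) - g (real k / 2 ^ n)) powr r)
              \<le> (s\<^sup>2) ^ n * H"
  shows "(\<Sum>j = 1..m. norm (g (a j) - g (a (j - 1))) powr r) \<le> chaining_const r s * H"
proof -
  define u where "u N j = nat \<lfloor>2 ^ N * a j\<rfloor>" for N j
  have up: "a j \<le> a m" if "j \<le> m" for j
    using that a(2) by (induction rule: inc_induct) (auto intro: order_trans)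
  have low: "0 \<le> a j" if "j \<le> m" for j
    using that a by (induction j) (auto intro: order_trans)
  have ur: "real (u N j) = real_of_int \<lfloor>2 ^ N * a j\<rfloor>" if "j \<le> m" for N j
    using low [OF that] by (simp add: u_def)
  have lim: "(\<lambda>N. g (real (u N j) / 2 ^ N)) \<longlonglongrightarrow> g (a j)" if j: "j \<le> m" for j
  proof (rule continuous_on_tendsto_compose [OF cont])
    have lo: "a j - (1/2) ^ N \<le> real (u N j) / 2 ^ N" and hi: "real (u N j) / 2 ^ N \<le> a j" for N
    proof -
      have "2 ^ N * a j - 1 \<le> real (u N j)" "real (u N j) \<le> 2 ^ N * a j"
        unfolding ur [OF j] by linarith+
      then have "(2 ^ N * a j - 1) / 2 ^ N \<le> real (u N j) / 2 ^ N"
          "real (u N j) / 2 ^ N \<le> 2 ^ N * a j / 2 ^ N"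
        by (intro divide_right_mono; simp)+
      then show "a j - (1/2) ^ N \<le> real (u N j) / 2 ^ N" "real (u N j) / 2 ^ N \<le> a j"
        by (simp_all add: diff_divide_distrib power_divide)
    qed
    have "(\<lambda>N. (1/2) ^ N) \<longlonglongrightarrow> (0::real)" by (simp add: LIMSEQ_realpow_zero)
    from tendsto_diff [OF tendsto_const [of "a j"] this]
    have lo_lim: "(\<lambda>N. a j - (1/2) ^ N) \<longlonglongrightarrow> a j" by simp
    show "(\<lambda>N. real (u N j) / 2 ^ N) \<longlonglongrightarrow> a j"
      by (rule tendsto_sandwich [OF _ _ lo_lim tendsto_const]) (simp_all add: lo hi)
    have "a j < 1" using up [OF j] a(3) by linarith
    then show "a j \<in> {0..<1}" using low [OF j] by simp
    show "\<forall>\<^sub>F N in sequentially. real (u N j) / 2 ^ N \<in> {0..<1}"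
      using le_less_trans [OF hi \<open>a j < 1\<close>]
      by (intro always_eventually allI) (simp only: atLeastLessThan_iff, simp)
  qed
  have "(\<lambda>N. \<Sum>j = 1..m. norm (g (real (u N j) / 2 ^ N) - g (real (u N (j - 1)) / 2 ^ N)) powr r)
      \<longlonglongrightarrow> (\<Sum>j = 1..m. norm (g (a j) - g (a (j - 1))) powr r)"
    by (intro tendsto_sum tendsto_powr' tendsto_norm tendsto_diff lim tendsto_const) (use r in auto)
  moreover have "(\<Sum>j = 1..m. norm (g (real (u N j) / 2 ^ N) - g (real (u N (j - 1)) / 2 ^ N)) powr r)
      \<le> chaining_const r s * H" for N
  proof (rule dyadic_variation_bound [OF r s _ _ E])
    show "u N j \<le> u N (Suc j)" if "j < m" for j
      unfolding u_def by (intro nat_mono floor_mono mult_left_mono a(2) that) auto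
    have "real (u N m) < real (2 ^ N)"
      unfolding ur [OF order_refl] using a(3) by (simp add: floor_less_iff) 
    then show "u N m < 2 ^ N" by (simp only: of_nat_less_iff)
  qed
  ultimately show ?thesis by (intro LIMSEQ_le_const2) auto
qed

section \<open>Variation of a path that is Hoelder continuous into a Lebesgue space\<close>
lemma power_powr_commute:
  fixes c :: real
  assumes "0 < c"
  shows "(c ^ n) powr x = (c powr x) ^ n"
proof -
  have "(c ^ n) powr x = (c powr real n) powr x" using assms by (simp add: powr_realpow)
  also have "\<dots> = (c powr x) powr real n" by (simp add: powr_powr mult.commute)
  also have "\<dots> = (c powr x) ^ n" using assms by (simp add: powr_realpow)
  finally show ?thesis .
qed

text \<open>
  Jensen's inequality for the uniform weights, rescaled. Indices with \<open>z k = 0\<close> are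
  removed first, since convexity of the power function is used on the positive half-line.
\<close>

lemma sum_powr_le_card_powr_mult_sum:
  fixes z :: "'i \<Rightarrow> real"
  assumes "finite A" "card A \<le> N" "1 \<le> s" and z: "\<And>k. k \<in> A \<Longrightarrow> 0 \<le> z k"
  shows "(\<Sum>k\<in>A. z k) powr s \<le> real N powr (s - 1) * (\<Sum>k\<in>A. z k powr s)"
proof -
  define B where "B = {k\<in>A. 0 < z k}"
  have B: "finite B" "B \<subseteq> A" using assms(1) by (auto simp: B_def)
  have eq1: "(\<Sum>k\<in>A. z k) = (\<Sum>k\<in>B. z k)"
    by (rule sum.mono_neutral_right) (use assms(1) z in \<open>force simp: B_def\<close>)+
  have eq2: "(\<Sum>k\<in>A. z k powr s) = (\<Sum>k\<in>B. z k powr s)"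
    by (rule sum.mono_neutral_right) (use assms(1) z in \<open>force simp: B_def\<close>)+
  show ?thesis
  proof (cases "B = {}")
    case True
    then show ?thesis using assms(3) eq1 eq2 by simp
  next
    case False
    define c where "c = real (card B)"
    have c: "0 < c" using False B by (simp add: c_def card_gt_0_iff)
    have cN: "c \<le> N" using card_mono [OF assms(1) B(2)] assms(2) by (simp add: c_def)
    have "(\<Sum>k\<in>B. (1 / c) *\<^sub>R z k) powr s \<le> (\<Sum>k\<in>B. (1 / c) * z k powr s)"
    proof (rule convex_on_sum [OF B(1) False powr_convex [OF assms(3)]])
      show "(\<Sum>k\<in>B. 1 / c) = 1" using c by (simp add: c_def)
    qed (use c in \<open>auto simp: B_def\<close>)
    then have "((1 / c) * (\<Sum>k\<in>B. z k)) powr s \<le> (1 / c) * (\<Sum>k\<in>B. z k powr s)"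
      by (simp add: sum_distrib_left)
    moreover have "0 \<le> (\<Sum>k\<in>B. z k)" by (rule sum_nonneg) (auto simp: B_def)
    ultimately have "(\<Sum>k\<in>B. z k) powr s \<le> c powr s * ((1 / c) * (\<Sum>k\<in>B. z k powr s))"
      using c by (simp add: powr_divide field_simps)
    also have "\<dots> = c powr (s - 1) * (\<Sum>k\<in>B. z k powr s)"
      using c by (simp add: powr_diff)
    also have "\<dots> \<le> real N powr (s - 1) * (\<Sum>k\<in>B. z k powr s)"
      using cN c assms(3) by (intro mult_right_mono powr_mono2 sum_nonneg) auto
    finally show ?thesis using eq1 eq2 by simp
  qed
qed

text \<open>
  The \<open>\<ell>\<^sup>\<rho>\<close> norm decreases in \<open>\<rho>\<close>: each term is at most the \<open>\<ell>\<^sup>r\<close> norm, so the additional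
  \<open>\<rho> - r\<close> powers can be pulled out of the sum.
\<close>

lemma sum_powr_powr_antimono:
  fixes z :: "'i \<Rightarrow> real"
  assumes "finite A" "0 < r" "r \<le> \<rho>" and z: "\<And>k. k \<in> A \<Longrightarrow> 0 \<le> z k"
  shows "(\<Sum>k\<in>A. z k powr \<rho>) powr (1 / \<rho>) \<le> (\<Sum>k\<in>A. z k powr r) powr (1 / r)"
proof -
  define Z where "Z = (\<Sum>k\<in>A. z k powr r)"
  have Z: "0 \<le> Z" by (simp add: Z_def sum_nonneg)
  have "z k powr \<rho> \<le> z k powr r * Z powr ((\<rho> - r) / r)" if k: "k \<in> A" for k
  proof -
    have "z k powr r \<le> Z"
      unfolding Z_def by (rule member_le_sum [OF k]) (use assms in auto)
    then have "(z k powr r) powr ((\<rho> - r) / r) \<le> Z powr ((\<rho> - r) / r)"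
      using assms by (intro powr_mono2) auto
    then have "z k powr (\<rho> - r) \<le> Z powr ((\<rho> - r) / r)"
      using assms by (simp add: powr_powr)
    then have "z k powr r * z k powr (\<rho> - r) \<le> z k powr r * Z powr ((\<rho> - r) / r)"
      by (intro mult_left_mono) auto
    then show ?thesis by (simp flip: powr_add)
  qed
  then have "(\<Sum>k\<in>A. z k powr \<rho>) \<le> (\<Sum>k\<in>A. z k powr r * Z powr ((\<rho> - r) / r))"
    by (rule sum_mono)
  also have "\<dots> = Z * Z powr ((\<rho> - r) / r)" by (simp add: Z_def sum_distrib_right)
  also have "\<dots> = Z powr (\<rho> / r)"
    using Z assms by (cases "Z = 0") (simp_all add: powr_mult_base field_simps)
  finally have "(\<Sum>k\<in>A. z k powr \<rho>) powr (1 / \<rho>) \<le> (Z powr (\<rho> / r)) powr (1 / \<rho>)"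
    using assms by (intro powr_mono2 sum_nonneg) auto
  then show ?thesis using assms by (simp add: powr_powr Z_def)
qed

text \<open>
  The reparametrisation \<open>T\<close> by the values of \<open>\<Lambda>\<close>, scaled to \<open>{0..<1}\<close>. The scale \<open>L\<close> is the supremum of \<open>\<Lambda>\<close>
  and not the given bound \<open>L0\<close>, so that every number in \<open>{0..<1}\<close> is attained. The supremum itself
  is not a value of \<open>\<Lambda>\<close>, which is why \<open>1\<close> is left out.
\<close>

lemma strictly_increasing_inverse:
  fixes \<Lambda> :: "real \<Rightarrow> real"
  assumes cont: "continuous_on {0..} \<Lambda>" and zero: "\<Lambda> 0 = 0"
    and strict: "\<And>s t. 0 \<le> s \<Longrightarrow> s < t \<Longrightarrow> \<Lambda> s < \<Lambda> t"
    and bdd: "\<And>t. 0 \<le> t \<Longrightarrow> \<Lambda> t \<le> L0"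
  obtains L T where "0 < L" "L \<le> L0"
    "\<And>t. 0 \<le> t \<Longrightarrow> \<Lambda> t / L \<in> {0..<1}" "\<And>t. 0 \<le> t \<Longrightarrow> T (\<Lambda> t / L) = t"
    "\<And>a. a \<in> {0..<1} \<Longrightarrow> 0 \<le> T a \<and> \<Lambda> (T a) = a * L"
    "continuous_on {0..<1} T"
proof -
  define L where "L = (SUP t\<in>{0..}. \<Lambda> t)"
  have bd: "bdd_above (\<Lambda> ` {0..})" using bdd by (auto intro!: bdd_aboveI)
  have le: "\<Lambda> t \<le> L" if "0 \<le> t" for t
    unfolding L_def using that by (intro cSUP_upper bd) auto
  have lt: "\<Lambda> t < L" if "0 \<le> t" for t
    using strict [of t "t + 1"] le [of "t + 1"] that by linarith
  have L: "0 < L" using lt [of 0] zero by simp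
  have LL0: "L \<le> L0" unfolding L_def by (rule cSUP_least) (use bdd in auto)
  have nonneg: "0 \<le> \<Lambda> t" if "0 \<le> t" for t
    using strict [of 0 t] zero that by (cases "t = 0") auto
  have surj: "\<exists>t\<ge>0. \<Lambda> t = a * L" if a: "a \<in> {0..<1}" for a
  proof -
    have "a * L < L" using a L by simp
    then obtain t where t: "0 \<le> t" "a * L < \<Lambda> t"
      unfolding L_def using less_cSUP_iff [OF _ bd] by auto
    have "\<exists>x\<ge>0. x \<le> t \<and> \<Lambda> x = a * L"
      by (rule IVT') (use t a L zero cont in \<open>auto intro: continuous_on_subset\<close>)
    then show ?thesis by blast
  qed
  define T where "T a = (SOME t. 0 \<le> t \<and> \<Lambda> t = a * L)" for a
  have T: "0 \<le> T a \<and> \<Lambda> (T a) = a * L" if "a \<in> {0..<1}" for a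
    unfolding T_def by (rule someI_ex) (use surj [OF that] in blast)
  have rng: "\<Lambda> t / L \<in> {0..<1}" if "0 \<le> t" for t
    using nonneg [OF that] lt [OF that] L by simp
  have inj: "s = t" if "0 \<le> s" "0 \<le> t" "\<Lambda> s = \<Lambda> t" for s t
    using strict [of s t] strict [of t s] that by (cases s t rule: linorder_cases) auto
  have TL: "T (\<Lambda> t / L) = t" if "0 \<le> t" for t
    using T [OF rng [OF that]] L that by (subst inj [of "T (\<Lambda> t / L)" t]) auto
  have less: "T a < T b \<longleftrightarrow> a < b" if ab: "a \<in> {0..<1}" "b \<in> {0..<1}" for a b
  proof -
    have "T a < T b \<longleftrightarrow> \<Lambda> (T a) < \<Lambda> (T b)"
      using strict [of "T a" "T b"] strict [of "T b" "T a"] T [OF ab(1)] T [OF ab(2)]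
      by (cases "T a" "T b" rule: linorder_cases) auto
    then show ?thesis using T [OF ab(1)] T [OF ab(2)] L by simp
  qed
  have "continuous_on {0..<1} T"
    unfolding continuous_on_def
  proof (intro ballI order_tendstoI)
    fix a y assume a: "a \<in> {0..<1::real}" and y: "y < T a"
    show "\<forall>\<^sub>F b in at a within {0..<1}. y < T b"
    proof (cases "0 \<le> y")
      case True
      then have "\<Lambda> y / L < a"
        using less [OF rng a] TL y by simp
      then have "\<forall>\<^sub>F b in at a within {0..<1}. \<Lambda> y / L < b"
        by (intro order_tendstoD [OF tendsto_ident_at])
      then show ?thesis
        using less [OF rng [OF True]] TL [OF True]
        by (auto simp: eventually_at_filter elim!: eventually_mono)
    next
      case False
      have "y < T b" if "b \<in> {0..<1}" for b using T [OF that] False by linarith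
      then show ?thesis by (simp add: eventually_at_filter)
    qed
  next
    fix a y assume a: "a \<in> {0..<1::real}" and y: "T a < y"
    then have "0 \<le> y" using T [OF a] by linarith
    then have "a < \<Lambda> y / L" using less [OF a rng] TL y by simp
    then have "\<forall>\<^sub>F b in at a within {0..<1}. b < \<Lambda> y / L"
      by (intro order_tendstoD [OF tendsto_ident_at])
    then show "\<forall>\<^sub>F b in at a within {0..<1}. T b < y"
      using less [OF _ rng [OF \<open>0 \<le> y\<close>]] TL [OF \<open>0 \<le> y\<close>]
      by (auto simp: eventually_at_filter elim!: eventually_mono)
  qed
  with that [OF L LL0 rng TL T] show ?thesis by blast
qed

text \<open>
  With \<open>s\<^sup>2 = 2 powr ((1 - r/p) / 2)\<close>, half of the decay \<open>2 powr (1 - r/p)\<close> per level is spent on the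
  pointwise decay that \<open>continuous_variation_bound\<close> requires, and the other half makes the series of
  integrals converge.
\<close>

definition variation_const :: "real \<Rightarrow> real \<Rightarrow> real \<Rightarrow> real" where
  "variation_const p q r =
     (let s = 2 powr ((1 - r / p) / 4) in
       (chaining_const r s powr (q / r) / (1 - s\<^sup>2 powr (q / r))) powr (1 / q))"

lemma variation_const_nonneg: "0 \<le> variation_const p q r"
  by (simp add: variation_const_def Let_def)

text \<open>
  A control \<open>H\<close> of the \<open>q\<close>-th power of the variation, the same for all partitions. On level \<open>n\<close> of the
  reparametrised path there are fewer than \<open>2\<^sup>n\<close> increments with \<open>L\<^sup>q\<close> norm at most
  \<open>K (L / 2\<^sup>n) powr (1/p)\<close>. Passing from \<open>\<ell>\<^sup>r\<close> to \<open>\<ell>\<^sup>q\<close> over these increments costs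
  \<open>2 powr (n (1/r - 1/q))\<close>, so the \<open>L\<^sup>q\<close> norm of their \<open>\<ell>\<^sup>r\<close> norm is of the size
  \<open>2 powr (n (1/r - 1/p))\<close>. The function \<open>H\<close> is a weighted sum over all levels, and its finiteness at
  a point provides the decay needed there. Integrating \<open>H\<close> avoids integrating a supremum over uncountably many
  partitions, which might not be measurable.
\<close>

proposition variation_bound_of_increments:
  fixes F :: "real \<Rightarrow> 'a \<Rightarrow> complex"
  assumes p: "0 < p" "p < r" and rq: "r < q" and r\<rho>: "r \<le> \<rho>"
    and meas: "\<And>t. 0 \<le> t \<Longrightarrow> F t \<in> borel_measurable M"
    and F_cont: "\<And>x. x \<in> space M \<Longrightarrow> continuous_on {0..} (\<lambda>t. F t x)"
    and \<Lambda>_cont: "continuous_on {0..} \<Lambda>" and zero: "\<Lambda> 0 = 0"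
    and strict: "\<And>s t. 0 \<le> s \<Longrightarrow> s < t \<Longrightarrow> \<Lambda> s < \<Lambda> t"
    and bdd: "\<And>t. 0 \<le> t \<Longrightarrow> \<Lambda> t \<le> L0"
    and K: "0 \<le> K"
    and incr: "\<And>s t. 0 \<le> s \<Longrightarrow> s < t \<Longrightarrow> (\<integral>\<^sup>+x. ennreal (norm (F t x - F s x) powr q) \<partial>M)
                 \<le> ennreal ((K * (\<Lambda> t - \<Lambda> s) powr (1 / p)) powr q)"
  obtains H :: "'a \<Rightarrow> ennreal" where
    "\<And>x (m::nat) t. x \<in> space M \<Longrightarrow> 0 < t 0 \<Longrightarrow> (\<And>j. j < m \<Longrightarrow> t j < t (Suc j)) \<Longrightarrow>
       ennreal (((\<Sum>j = 1..m. norm (F (t j) x - F (t (j - 1)) x) powr \<rho>) powr (1 / \<rho>)) powr q) \<le> H x"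
    "(\<integral>\<^sup>+x. H x \<partial>M) \<le> ennreal ((variation_const p q r * K * L0 powr (1 / p)) powr q)"
proof -
  obtain L T where L: "0 < L" "L \<le> L0"
    and rng: "\<And>t. 0 \<le> t \<Longrightarrow> \<Lambda> t / L \<in> {0..<1}" and TL: "\<And>t. 0 \<le> t \<Longrightarrow> T (\<Lambda> t / L) = t"
    and T: "\<And>a. a \<in> {0..<1} \<Longrightarrow> 0 \<le> T a \<and> \<Lambda> (T a) = a * L"
    and T_cont: "continuous_on {0..<1} T"
    using strictly_increasing_inverse [OF \<Lambda>_cont zero strict bdd] by metis
  define s where "s = 2 powr ((1 - r / p) / 4)"
  have "s < 2 powr 0" unfolding s_def by (rule powr_less_mono) (use p in auto)
  then have s: "0 < s" "s < 1" by (auto simp: s_def)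
  have r: "0 < r" "0 < q" using p rq by auto
  define \<beta> where "\<beta> = s\<^sup>2 powr (q / r)"
  have s2: "s\<^sup>2 < 1" "0 < s\<^sup>2" using s by (auto simp: power_less_one_iff)
  have \<beta>: "0 < \<beta>" "\<beta> < 1"
    using s2 r powr_less_mono2 [of "q / r" "s\<^sup>2" 1] s by (auto simp: \<beta>_def)
  define G where "G x a = F (T a) x" for x a
  define \<Delta> where "\<Delta> n k x = norm (G x (real (Suc k) / 2 ^ n) - G x (real k / 2 ^ n))" for n k x
  define I where "I n = {k. Suc k < 2 ^ n}" for n :: nat
  have "I n \<subseteq> {..<2 ^ n}" for n unfolding I_def by auto
  then have I: "finite (I n)" "card (I n) \<le> 2 ^ n" for n
    using card_mono [of "{..<2 ^ n}" "I n"] finite_subset [of "I n" "{..<2 ^ n}"] by auto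
  have dy: "real k / 2 ^ n \<in> {0..<1}" if "k < 2 ^ n" for k n :: nat
    using that by (simp add: of_nat_less_numeral_power_cancel_iff divide_simps)
  define E where "E n x = (\<Sum>k\<in>I n. \<Delta> n k x powr r)" for n x
  define h where "h n x = ennreal ((E n x / (s\<^sup>2) ^ n) powr (q / r))" for n x
  define C where "C = chaining_const r s"
  have C: "0 \<le> C" using s by (simp add: C_def chaining_const_nonneg)
  have C0: "0 < C" unfolding C_def chaining_const_def
    using s r powr_less_mono2 [of "1 / r" s 1] by simp
  define H where "H x = ennreal (C powr (q / r)) * (\<Sum>n. h n x)" for x
  have \<Delta>_meas [measurable]: "\<Delta> n k \<in> borel_measurable M" if "k \<in> I n" for n k
  proof -
    have "0 \<le> T (real k / 2 ^ n)" "0 \<le> T (real (Suc k) / 2 ^ n)"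
      using that T [OF dy [of k n]] T [OF dy [of "Suc k" n]] by (auto simp: I_def)
    note [measurable] = meas [OF this(1)] meas [OF this(2)]
    show ?thesis unfolding \<Delta>_def G_def by measurable
  qed
  have E_meas [measurable]: "E n \<in> borel_measurable M" for n
    unfolding E_def by measurable
  have h_meas [measurable]: "h n \<in> borel_measurable M" for n
    unfolding h_def by measurable
  have \<Delta>_int: "(\<integral>\<^sup>+x. ennreal (\<Delta> n k x powr q) \<partial>M)
      \<le> ennreal (K powr q * (L / 2 ^ n) powr (q / p))" if k: "k \<in> I n" for n k
  proof -
    let ?a = "T (real k / 2 ^ n)" and ?b = "T (real (Suc k) / 2 ^ n)"
    have a: "0 \<le> ?a" "\<Lambda> ?a = real k / 2 ^ n * L" and b: "0 \<le> ?b" "\<Lambda> ?b = real (Suc k) / 2 ^ n * L"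
      using T [OF dy [of k n]] T [OF dy [of "Suc k" n]] k by (auto simp: I_def)
    have d: "\<Lambda> ?b - \<Lambda> ?a = L / 2 ^ n" using a b by (simp add: field_simps)
    have "?a < ?b"
    proof (rule ccontr)
      assume "\<not> ?a < ?b"
      then have "\<Lambda> ?b \<le> \<Lambda> ?a" using strict [of ?b ?a] b(1) by (cases "?a = ?b") auto
      moreover have "0 < L / 2 ^ n" using L by simp
      ultimately show False using d by linarith
    qed
    from incr [OF a(1) this]
    have "(\<integral>\<^sup>+x. ennreal (\<Delta> n k x powr q) \<partial>M) \<le> ennreal ((K * (L / 2 ^ n) powr (1 / p)) powr q)"
      unfolding d \<Delta>_def G_def .
    also have "(K * (L / 2 ^ n) powr (1 / p)) powr q = K powr q * (L / 2 ^ n) powr (q / p)"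
      using K L p by (simp add: powr_mult powr_powr)
    finally show ?thesis .
  qed
  have h_int: "(\<integral>\<^sup>+x. h n x \<partial>M) \<le> ennreal (K powr q * L powr (q / p) * \<beta> ^ n)" for n
  proof -
    have "(E n x / (s\<^sup>2) ^ n) powr (q / r)
        \<le> ((2 ^ n) powr (q / r - 1) / \<beta> ^ n) * (\<Sum>k\<in>I n. \<Delta> n k x powr q)" for x
    proof -
      have "(E n x / (s\<^sup>2) ^ n) powr (q / r) = E n x powr (q / r) / \<beta> ^ n"
        using s2 by (simp add: powr_divide E_def sum_nonneg \<beta>_def power_powr_commute)
      also have "E n x powr (q / r)
          \<le> real (2 ^ n) powr (q / r - 1) * (\<Sum>k\<in>I n. (\<Delta> n k x powr r) powr (q / r))"
        unfolding E_def
        by (rule sum_powr_le_card_powr_mult_sum) (use I rq r in \<open>auto simp: \<Delta>_def\<close>)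
      also have "(\<Sum>k\<in>I n. (\<Delta> n k x powr r) powr (q / r)) = (\<Sum>k\<in>I n. \<Delta> n k x powr q)"
        using r by (simp add: powr_powr)
      finally show ?thesis using \<beta> by (simp add: divide_right_mono)
    qed
    then have "(\<integral>\<^sup>+x. h n x \<partial>M) \<le> (\<integral>\<^sup>+x. ennreal ((2 ^ n) powr (q / r - 1) / \<beta> ^ n) *
        (\<Sum>k\<in>I n. ennreal (\<Delta> n k x powr q)) \<partial>M)"
      using \<beta> unfolding h_def
      by (intro nn_integral_mono) (simp add: sum_ennreal sum_nonneg flip: ennreal_mult)
    also have "\<dots> = ennreal ((2 ^ n) powr (q / r - 1) / \<beta> ^ n) *
        (\<Sum>k\<in>I n. \<integral>\<^sup>+x. ennreal (\<Delta> n k x powr q) \<partial>M)"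
    proof -
      have D: "(\<lambda>x. ennreal (\<Delta> n k x powr q)) \<in> borel_measurable M" if "k \<in> I n" for k
        using \<Delta>_meas [OF that] by measurable
      show ?thesis
        by (subst nn_integral_sum [of "I n", OF D, symmetric], assumption, rule nn_integral_cmult)
          (intro borel_measurable_sum D)
    qed
    also have "\<dots> \<le> ennreal ((2 ^ n) powr (q / r - 1) / \<beta> ^ n) *
        (\<Sum>k\<in>I n. ennreal (K powr q * (L / 2 ^ n) powr (q / p)))"
      by (intro mult_left_mono sum_mono \<Delta>_int) auto
    also have "\<dots> = ennreal ((2 ^ n) powr (q / r - 1) / \<beta> ^ n * (card (I n) * (K powr q * (L / 2 ^ n) powr (q / p))))"
      using \<beta> by (subst sum_ennreal) (auto simp flip: ennreal_mult)
    also have "\<dots> \<le> ennreal ((2 ^ n) powr (q / r - 1) / \<beta> ^ n * (2 ^ n * (K powr q * (L / 2 ^ n) powr (q / p))))"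
    proof (intro ennreal_leI mult_left_mono mult_right_mono)
      show "real (card (I n)) \<le> 2 ^ n" using I(2) [of n] by (metis of_nat_le_iff of_nat_numeral of_nat_power)
    qed (use \<beta> in auto)
    also have "(2 ^ n) powr (q / r - 1) / \<beta> ^ n * (2 ^ n * (K powr q * (L / 2 ^ n) powr (q / p)))
        = K powr q * L powr (q / p) * \<beta> ^ n"
    proof -
      have "s\<^sup>2 = 2 powr ((1 - r / p) / 2)"
        by (simp add: s_def power2_eq_square flip: powr_add)
      then have \<beta>2: "\<beta> = 2 powr ((1 - r / p) / 2 * (q / r))"
        by (simp add: \<beta>_def powr_powr)
      have "(2 ^ n) powr (q / r - 1) * (2 ^ n) * (1 / 2 ^ n) powr (q / p) = \<beta> ^ n * \<beta> ^ n"
      proof -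
        have core: "2 powr (q / r - 1) * 2 powr 1 * 2 powr (- (q / p)) = \<beta> * \<beta>"
          unfolding \<beta>2 powr_add [symmetric]
          by (rule arg_cong [where f = "\<lambda>x. 2 powr x"]) (use r p in \<open>simp add: field_simps\<close>)
        have e1: "(1 / 2 ^ n) powr (q / p) = (2 powr (- (q / p))) ^ n"
          by (simp add: powr_divide power_powr_commute powr_minus_divide power_divide)
        have e2: "((2::real) ^ n) powr (q / r - 1) = (2 powr (q / r - 1)) ^ n"
          by (rule power_powr_commute) simp
        have "(2 ^ n) powr (q / r - 1) * (2 ^ n) * (1 / 2 ^ n) powr (q / p)
            = (2 powr (q / r - 1) * 2 powr 1 * 2 powr (- (q / p))) ^ n"
          unfolding e1 e2 power_mult_distrib by simp
        then show ?thesis unfolding core power_mult_distrib .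
      qed
      moreover have "(L / 2 ^ n) powr (q / p) = L powr (q / p) * (1 / 2 ^ n) powr (q / p)"
        using L by (simp add: powr_divide)
      ultimately show ?thesis using \<beta> by (simp add: field_simps)
    qed
    finally show ?thesis .
  qed
  have "(\<integral>\<^sup>+x. H x \<partial>M) = ennreal (C powr (q / r)) * (\<Sum>n. \<integral>\<^sup>+x. h n x \<partial>M)"
    unfolding H_def by (subst nn_integral_cmult) (auto simp: nn_integral_suminf)
  also have "\<dots> \<le> ennreal (C powr (q / r)) * (\<Sum>n. ennreal (K powr q * L powr (q / p) * \<beta> ^ n))"
    by (intro mult_left_mono suminf_le h_int) auto
  also have "(\<Sum>n. ennreal (K powr q * L powr (q / p) * \<beta> ^ n))
      = ennreal (K powr q * L powr (q / p) * (1 / (1 - \<beta>)))"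
    using \<beta> by (intro sums_unique [symmetric] sums_ennreal [THEN iffD2] sums_mult geometric_sums) auto
  also have "ennreal (C powr (q / r)) * \<dots> = ennreal (C powr (q / r) / (1 - \<beta>) * K powr q * L powr (q / p))"
    using \<beta> by (simp flip: ennreal_mult add: ac_simps)
  also have "\<dots> \<le> ennreal (C powr (q / r) / (1 - \<beta>) * K powr q * L0 powr (q / p))"
    using \<beta> L p r by (intro ennreal_leI mult_left_mono powr_mono2) auto
  also have "C powr (q / r) / (1 - \<beta>) * K powr q * L0 powr (q / p)
      = (variation_const p q r * K * L0 powr (1 / p)) powr q"
    using K L r p \<beta> by (simp add: powr_mult powr_powr variation_const_def Let_def C_def \<beta>_def s_def)
  finally have H_int: "(\<integral>\<^sup>+x. H x \<partial>M) \<le> \<dots>" .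
  have "ennreal (((\<Sum>j = 1..m. norm (F (t j) x - F (t (j - 1)) x) powr \<rho>) powr (1 / \<rho>)) powr q) \<le> H x"
    if x: "x \<in> space M" and t0: "0 < t 0" and tm: "\<And>j. j < m \<Longrightarrow> t j < t (Suc j)" for x m t
  proof (cases "(\<Sum>n. h n x) = top")
    case True
    then show ?thesis using C0 by (simp add: H_def ennreal_mult_top)
  next
    case False
    define Y where "Y = (\<Sum>n. (E n x / (s\<^sup>2) ^ n) powr (q / r))"
    have summ: "summable (\<lambda>n. (E n x / (s\<^sup>2) ^ n) powr (q / r))"
      by (rule summable_suminf_not_top) (use False in \<open>auto simp: h_def\<close>)
    have Y: "(\<Sum>n. h n x) = ennreal Y"
      unfolding h_def Y_def by (rule suminf_ennreal2) (use summ in auto)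
    have Y0: "0 \<le> Y" unfolding Y_def by (rule suminf_nonneg [OF summ]) auto
    define a where "a j = \<Lambda> (t j) / L" for j
    have tpos: "0 < t j" if "j \<le> m" for j
      using that t0 tm by (induction j) (auto intro: less_trans)
    have E_le: "(\<Sum>k | Suc k < 2 ^ n. norm (G x (real (Suc k) / 2 ^ n) - G x (real k / 2 ^ n)) powr r)
        \<le> (s\<^sup>2) ^ n * Y powr (r / q)" for n
    proof -
      have E0: "0 \<le> E n x" by (simp add: E_def sum_nonneg)
      have "(E n x / (s\<^sup>2) ^ n) powr (q / r) \<le> Y"
        unfolding Y_def using sum_le_suminf [OF summ, of "{n}"] by simp
      then have "((E n x / (s\<^sup>2) ^ n) powr (q / r)) powr (r / q) \<le> Y powr (r / q)"
        using r by (intro powr_mono2) auto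
      then have "E n x / (s\<^sup>2) ^ n \<le> Y powr (r / q)"
        using r E0 by (simp add: powr_powr)
      then have "E n x \<le> (s\<^sup>2) ^ n * Y powr (r / q)"
        using s2 by (simp add: field_simps)
      then show ?thesis by (simp add: E_def \<Delta>_def I_def)
    qed
    have G_cont: "continuous_on {0..<1} (G x)"
      unfolding G_def by (rule continuous_on_compose2 [OF F_cont [OF x] T_cont]) (use T in auto)
    have "(\<Sum>j = 1..m. norm (G x (a j) - G x (a (j - 1))) powr r) \<le> C * Y powr (r / q)"
      unfolding C_def
    proof (rule continuous_variation_bound [OF r(1) s G_cont _ _ _ E_le])
      show "a j \<le> a (Suc j)" if "j < m" for j
        using strict [OF _ tm [OF that]] tpos [of j] that L by (simp add: a_def divide_right_mono)
    qed (use rng [of "t 0"] rng [of "t m"] t0 tpos [of m] in \<open>auto simp: a_def\<close>)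
    also have "(\<Sum>j = 1..m. norm (G x (a j) - G x (a (j - 1))) powr r)
        = (\<Sum>j = 1..m. norm (F (t j) x - F (t (j - 1)) x) powr r)"
    proof (rule sum.cong [OF refl])
      fix j assume j: "j \<in> {1..m}"
      then have "0 \<le> t j" "0 \<le> t (j - 1)"
        using tpos [of j] tpos [of "j - 1"] by (auto intro: less_imp_le)
      then have "T (a j) = t j" "T (a (j - 1)) = t (j - 1)"
        unfolding a_def by (auto intro!: TL)
      then show "norm (G x (a j) - G x (a (j - 1))) powr r = norm (F (t j) x - F (t (j - 1)) x) powr r"
        by (simp add: G_def)
    qed
    finally have *: "(\<Sum>j = 1..m. norm (F (t j) x - F (t (j - 1)) x) powr r) \<le> C * Y powr (r / q)" .
    have "(\<Sum>j = 1..m. norm (F (t j) x - F (t (j - 1)) x) powr \<rho>) powr (1 / \<rho>)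
        \<le> (\<Sum>j = 1..m. norm (F (t j) x - F (t (j - 1)) x) powr r) powr (1 / r)"
      by (rule sum_powr_powr_antimono) (use r r\<rho> in auto)
    also have "\<dots> \<le> (C * Y powr (r / q)) powr (1 / r)"
      using * r by (intro powr_mono2 sum_nonneg) auto
    also have "\<dots> = C powr (1 / r) * Y powr (1 / q)"
      using C Y0 r by (simp add: powr_mult powr_powr)
    finally have "((\<Sum>j = 1..m. norm (F (t j) x - F (t (j - 1)) x) powr \<rho>) powr (1 / \<rho>)) powr q
        \<le> (C powr (1 / r) * Y powr (1 / q)) powr q"
      using r by (intro powr_mono2) auto
    also have "\<dots> = C powr (q / r) * Y"
      using C Y0 r by (simp add: powr_mult powr_powr)
    finally show ?thesis
      unfolding H_def Y using C Y0 by (simp flip: ennreal_mult)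
  qed
  then show thesis using that H_int by blast
qed

section \<open>Smooth functions and cutoffs\<close>
lemma Rn_upd [simp]: "x \<in> Rn d \<Longrightarrow> i < d \<Longrightarrow> x(i := s) \<in> Rn d"
  by (auto simp: Rn_def PiE_def extensional_def)

lemma scalen_in_Rn [simp]: "scalen d t x \<in> Rn d"
  by (auto simp: Rn_def scalen_def)

lemma minusn_in_Rn [simp]: "minusn d x y \<in> Rn d"
  by (auto simp: Rn_def minusn_def)

lemma scalen_upd: "i < d \<Longrightarrow> scalen d t (x(i := s)) = (scalen d t x)(i := t * s)"
  by (auto simp: scalen_def fun_eq_iff)

lemma continuous_on_scalen: "continuous_on A (scalen d t)"
  unfolding scalen_def
proof (rule continuous_on_coordinatewise_then_product)
  fix i
  show "continuous_on A (\<lambda>x. restrict (\<lambda>i. t * x i) {..<d} i)"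
    by (cases "i < d") (auto intro!: continuous_intros continuous_on_subset [OF continuous_on_product_coordinates])
qed

lemma continuous_on_normn: "continuous_on A (normn d)"
  unfolding normn_def L2_set_def
  by (auto intro!: continuous_intros continuous_on_subset [OF continuous_on_product_coordinates])

text \<open>
  Differentiability of finite order by recursion on the order. Products obey Leibniz' rule in this form by
  induction, without formulas for iterated derivatives.
\<close>

fun Ck :: "nat \<Rightarrow> nat \<Rightarrow> ((nat \<Rightarrow> real) \<Rightarrow> complex) \<Rightarrow> bool" where
  "Ck d 0 g \<longleftrightarrow> continuous_on (Rn d) g"
| "Ck d (Suc n) g \<longleftrightarrow> continuous_on (Rn d) g \<and>
     (\<forall>i<d. \<forall>x\<in>Rn d. (\<lambda>s. g (x(i := s))) differentiable (at (x i))) \<and> (\<forall>i<d. Ck d n (pdiff i g))"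

lemma smoothn_pdiff: "smoothn d g \<Longrightarrow> i < d \<Longrightarrow> smoothn d (pdiff i g)"
  unfolding smoothn_def
proof (intro allI impI)
  fix js
  assume *: "\<forall>js. set js \<subseteq> {..<d} \<longrightarrow> continuous_on (Rn d) (foldr pdiff js g) \<and>
      (\<forall>i<d. \<forall>x\<in>Rn d. (\<lambda>s. foldr pdiff js g (x(i := s))) differentiable (at (x i)))"
    and "i < d" "set js \<subseteq> {..<d}"
  then have "set (js @ [i]) \<subseteq> {..<d}" by simp
  from * [rule_format, OF this]
  show "continuous_on (Rn d) (foldr pdiff js (pdiff i g)) \<and>
      (\<forall>j<d. \<forall>x\<in>Rn d. (\<lambda>s. foldr pdiff js (pdiff i g) (x(j := s))) differentiable (at (x j)))"
    by simp
qed

lemma smoothn_imp_Ck: "smoothn d g \<Longrightarrow> Ck d n g"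
proof (induction n arbitrary: g)
  case 0
  then show ?case unfolding smoothn_def by (auto dest: spec [of _ "[]"])
next
  case (Suc n)
  then have "continuous_on (Rn d) g"
    "\<forall>i<d. \<forall>x\<in>Rn d. (\<lambda>s. g (x(i := s))) differentiable (at (x i))"
    unfolding smoothn_def by (auto dest: spec [of _ "[]"])
  then show ?case using Suc by (simp add: smoothn_pdiff)
qed

lemma smoothn_iff_Ck: "smoothn d g \<longleftrightarrow> (\<forall>n. Ck d n g)"
proof
  assume "\<forall>n. Ck d n g"
  then have "continuous_on (Rn d) (foldr pdiff js g) \<and>
     (\<forall>i<d. \<forall>x\<in>Rn d. (\<lambda>s. foldr pdiff js g (x(i := s))) differentiable (at (x i)))"
    if "set js \<subseteq> {..<d}" for js
    using that
  proof (induction js arbitrary: g rule: rev_induct)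
    case Nil
    then show ?case using spec [OF Nil.prems(1), of "Suc 0"] by (simp del: fun_upd_apply)
  next
    case (snoc i js)
    have "\<forall>n. Ck d n (pdiff i g)"
    proof
      fix n
      show "Ck d n (pdiff i g)"
        using spec [OF snoc.prems(1), of "Suc n"] snoc.prems(2) by (simp del: fun_upd_apply)
    qed
    from snoc.IH [OF this] show ?case using snoc.prems by simp
  qed
  then show "smoothn d g" unfolding smoothn_def by blast
qed (simp add: smoothn_imp_Ck)

lemma Ck_continuous: "Ck d n g \<Longrightarrow> continuous_on (Rn d) g"
  by (cases n) auto

lemma Ck_decrease: "Ck d (Suc n) g \<Longrightarrow> Ck d n g"
  by (induction n arbitrary: g) auto

text \<open>
  Only the values on \<open>Rn d\<close> matter. This allows \<open>pdiff\<close> to be replaced by any explicit formula that is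
  correct there.
\<close>

lemma Ck_cong:
  assumes "Ck d n g" "\<And>x. x \<in> Rn d \<Longrightarrow> g x = h x"
  shows "Ck d n h"
  using assms
proof (induction n arbitrary: g h)
  case 0
  then show ?case by (auto cong: continuous_on_cong)
next
  case (Suc n)
  have eq: "(\<lambda>s. g (x(i := s))) = (\<lambda>s. h (x(i := s)))" if "x \<in> Rn d" "i < d" for x i
    using Suc.prems(2) [OF Rn_upd [OF that]] by (rule ext)
  have "pdiff i g x = pdiff i h x" if "x \<in> Rn d" "i < d" for x i
    unfolding pdiff_def eq [OF that] ..
  then have "Ck d n (pdiff i h)" if "i < d" for i
    using that Suc.prems(1) by (auto intro: Suc.IH [of "pdiff i g" "pdiff i h"])
  moreover have "continuous_on (Rn d) h"
    using Suc.prems by (auto cong: continuous_on_cong)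
  ultimately show ?case using Suc.prems(1) eq by auto
qed

lemma Ck_has_vector_derivative:
  assumes "Ck d (Suc n) g" "i < d" "x \<in> Rn d"
  shows "((\<lambda>s. g (x(i := s))) has_vector_derivative pdiff i g x) (at (x i))"
  using assms vector_derivative_works by (force simp: pdiff_def)

lemma Ck_SucI:
  assumes cont: "continuous_on (Rn d) g"
    and der: "\<And>i x. i < d \<Longrightarrow> x \<in> Rn d \<Longrightarrow> ((\<lambda>s. g (x(i := s))) has_vector_derivative g' i x) (at (x i))"
    and Ck: "\<And>i. i < d \<Longrightarrow> Ck d n (g' i)"
  shows "Ck d (Suc n) g"
proof -
  have "pdiff i g x = g' i x" if "i < d" "x \<in> Rn d" for i x
    unfolding pdiff_def by (rule vector_derivative_at [OF der [OF that]])
  then have "Ck d n (pdiff i g)" if "i < d" for i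
    using that by (auto intro: Ck_cong [OF Ck])
  then show ?thesis
    using cont der by (auto intro: differentiableI_vector)
qed

lemma Ck_const: "Ck d n (\<lambda>x. c)"
proof (induction n arbitrary: c)
  case (Suc n)
  show ?case by (rule Ck_SucI [where g' = "\<lambda>i x. 0"]) (auto intro: Suc)
qed simp

lemma Ck_add:
  assumes "Ck d n g" "Ck d n h"
  shows "Ck d n (\<lambda>x. g x + h x)"
  using assms
proof (induction n arbitrary: g h)
  case 0
  then show ?case by (auto intro: continuous_intros)
next
  case (Suc n)
  show ?case
  proof (rule Ck_SucI)
    show "continuous_on (Rn d) (\<lambda>x. g x + h x)"
      using Suc.prems by (auto intro: continuous_intros)
    show "((\<lambda>s. g (x(i := s)) + h (x(i := s))) has_vector_derivative pdiff i g x + pdiff i h x) (at (x i))"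
      if "i < d" "x \<in> Rn d" for i x
      using Suc.prems that by (intro has_vector_derivative_add Ck_has_vector_derivative)
    show "Ck d n (\<lambda>x. pdiff i g x + pdiff i h x)" if "i < d" for i
      using Suc.prems that by (intro Suc.IH) auto
  qed
qed

lemma Ck_mult:
  assumes "Ck d n g" "Ck d n h"
  shows "Ck d n (\<lambda>x. g x * h x)"
  using assms
proof (induction n arbitrary: g h)
  case 0
  then show ?case by (auto intro: continuous_intros)
next
  case (Suc n)
  show ?case
  proof (rule Ck_SucI)
    show "continuous_on (Rn d) (\<lambda>x. g x * h x)"
      using Suc.prems by (auto intro: continuous_intros)
    show "((\<lambda>s. g (x(i := s)) * h (x(i := s))) has_vector_derivative
        g x * pdiff i h x + pdiff i g x * h x) (at (x i))"
      if "i < d" "x \<in> Rn d" for i x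
      using has_vector_derivative_mult [OF Ck_has_vector_derivative [OF Suc.prems(1) that]
          Ck_has_vector_derivative [OF Suc.prems(2) that]] by (simp only: fun_upd_triv)
    show "Ck d n (\<lambda>x. g x * pdiff i h x + pdiff i g x * h x)" if "i < d" for i
      using Suc.prems that
      by (intro Ck_add Suc.IH Ck_decrease [OF Suc.prems(1)] Ck_decrease [OF Suc.prems(2)]) auto
  qed
qed

lemma Ck_scalen:
  assumes "Ck d n g"
  shows "Ck d n (\<lambda>x. g (scalen d t x))"
  using assms
proof (induction n arbitrary: g)
  case 0
  then have "continuous_on (Rn d) g" by simp
  then show ?case
    unfolding Ck.simps by (rule continuous_on_compose2 [OF _ continuous_on_scalen]) auto
next
  case (Suc n)
  show ?case
  proof (rule Ck_SucI)
    show "continuous_on (Rn d) (\<lambda>x. g (scalen d t x))"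
      by (rule continuous_on_compose2 [OF Ck_continuous [OF Suc.prems] continuous_on_scalen]) auto
    show "((\<lambda>s. g (scalen d t (x(i := s)))) has_vector_derivative
        of_real t * pdiff i g (scalen d t x)) (at (x i))" if "i < d" "x \<in> Rn d" for i x
    proof -
      let ?y = "scalen d t x"
      have "?y i = t * x i" using that by (simp add: scalen_def)
      with Ck_has_vector_derivative [OF Suc.prems that(1), of ?y]
      have "((\<lambda>s. g (?y(i := s))) has_vector_derivative pdiff i g ?y) (at (t * x i))"
        by (simp del: fun_upd_apply)
      moreover have "((\<lambda>s. t * s) has_vector_derivative t) (at (x i))"
        by (auto intro!: derivative_eq_intros)
      ultimately have "((\<lambda>s. g (?y(i := s))) \<circ> (\<lambda>s. t * s) has_vector_derivative t *\<^sub>R pdiff i g ?y) (at (x i))"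
        by (intro vector_diff_chain_at) auto
      then show ?thesis
        using that by (simp add: o_def scalen_upd scaleR_conv_of_real)
    qed
    show "Ck d n (\<lambda>x. of_real t * pdiff i g (scalen d t x))" if "i < d" for i
      using Suc.prems that by (intro Ck_mult Ck_const Suc.IH) auto
  qed
qed

text \<open>
  A smooth function of one real variable is represented by the sequence \<open>U\<close> of its derivatives. The
  general coefficient \<open>c\<close> and the index \<open>k\<close> keep the family closed under partial derivatives, zero included.
\<close>

lemma Ck_coordinate:
  fixes U :: "nat \<Rightarrow> real \<Rightarrow> real"
  assumes U: "\<And>k s. (U k has_real_derivative U (Suc k) s) (at s)" and i: "i < d"
  shows "Ck d n (\<lambda>x. of_real (c * U k (a + b * x i)))"
proof -
  have cont: "continuous_on (Rn d) (\<lambda>x. complex_of_real (c * U k (a + b * x i)))" for c k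
  proof -
    have "isCont (U k) s" for s by (rule DERIV_isCont [OF U])
    then have "continuous_on UNIV (U k)" by (simp add: continuous_at_imp_continuous_on)
    moreover have "continuous_on (Rn d) (\<lambda>x. a + b * x i)"
      by (intro continuous_intros continuous_on_subset [OF continuous_on_product_coordinates]) simp
    ultimately have "continuous_on (Rn d) (\<lambda>x. U k (a + b * x i))"
      by (rule continuous_on_compose2) simp
    then show ?thesis by (intro continuous_intros)
  qed
  show ?thesis
  proof (induction n arbitrary: c k)
    case 0
    show ?case using cont by simp
  next
    case (Suc n)
    have *: "((\<lambda>s. c * U k (a + b * s)) has_real_derivative c * (U (Suc k) (a + b * y) * b)) (at y)" for y
      by (rule DERIV_cmult, rule DERIV_chain2 [OF U]) (auto intro!: derivative_eq_intros)
    show ?case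
    proof (rule Ck_SucI)
      show "continuous_on (Rn d) (\<lambda>x. complex_of_real (c * U k (a + b * x i)))"
        by (rule cont)
      show "((\<lambda>s. complex_of_real (c * U k (a + b * (x(j := s)) i))) has_vector_derivative
          of_real ((if j = i then c * b else 0) * U (Suc k) (a + b * x i))) (at (x j))" for j x
      proof (cases "j = i")
        case True
        from has_vector_derivative_of_real [OF * [of "x i"]]
        show ?thesis using True by (simp add: mult_ac)
      qed simp
      show "Ck d n (\<lambda>x. complex_of_real ((if j = i then c * b else 0) * U (Suc k) (a + b * x i)))" for j
        by (rule Suc)
    qed
  qed
qed

lemma Ck_prod:
  assumes "finite I" "\<And>i. i \<in> I \<Longrightarrow> Ck d n (f i)"
  shows "Ck d n (\<lambda>x. \<Prod>i\<in>I. f i x)"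
  using assms by (induction I rule: finite_induct) (auto intro: Ck_const Ck_mult)

text \<open>
  The family generated by the classical flat function \<open>exp (- 1 / x)\<close> under differentiation: the
  polynomial factors in \<open>1 / x\<close> are exactly what the chain rule produces.
\<close>

definition flat :: "real poly \<Rightarrow> real \<Rightarrow> real" where
  "flat P x = (if 0 < x then poly P (1 / x) * exp (- 1 / x) else 0)"

lemma poly_times_exp_tendsto_0: "((\<lambda>y. poly P y * exp (- y)) \<longlongrightarrow> (0::real)) at_top"
proof -
  have "((\<lambda>y. \<Sum>i\<le>degree P. coeff P i * (y ^ i / exp y)) \<longlongrightarrow> (\<Sum>i\<le>degree P. coeff P i * 0)) at_top"
    by (intro tendsto_sum tendsto_mult tendsto_const tendsto_power_div_exp_0)
  then show ?thesis
    by (simp add: poly_altdef sum_distrib_right exp_minus divide_inverse mult.assoc)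
qed

lemma flat_has_derivative:
  "(flat P has_real_derivative flat ((P - pderiv P) * [:0, 0, 1:]) x) (at x)"
proof (cases x "0::real" rule: linorder_cases)
  case less
  then have "\<forall>\<^sub>F y in nhds x. (0::real) = flat P y"
    by (intro eventually_nhds_in_open [of "{..<0}", THEN eventually_mono]) (auto simp: flat_def)
  then show ?thesis
    using less DERIV_cong_ev [of x x "\<lambda>_. 0" "flat P" 0 0] by (simp add: flat_def)
next
  case greater
  have "((\<lambda>x. poly P (1 / x) * exp (- 1 / x)) has_real_derivative
      poly ((P - pderiv P) * [:0, 0, 1:]) (1 / x) * exp (- 1 / x)) (at x)"
    using greater
    by (auto intro!: derivative_eq_intros DERIV_chain2 [OF poly_DERIV]
        simp: power2_eq_square algebra_simps divide_simps)
  moreover have "\<forall>\<^sub>F y in nhds x. poly P (1 / y) * exp (- 1 / y) = flat P y"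
    using greater
    by (intro eventually_nhds_in_open [of "{0<..}", THEN eventually_mono]) (auto simp: flat_def)
  ultimately show ?thesis
    using greater DERIV_cong_ev [of x x "\<lambda>x. poly P (1 / x) * exp (- 1 / x)" "flat P"]
    by (simp add: flat_def)
next
  case equal
  have "((\<lambda>h. flat P h / h) \<longlongrightarrow> 0) (at_left 0)"
    by (rule tendsto_eventually) (auto simp: flat_def eventually_at_left_field intro: exI [of _ "-1"])
  moreover have "((\<lambda>h. flat P h / h) \<longlongrightarrow> 0) (at_right 0)"
  proof -
    have "((\<lambda>h::real. poly (P * [:0, 1:]) (inverse h) * exp (- (inverse h))) \<longlongrightarrow> 0) (at_right 0)"
      by (rule filterlim_compose [OF poly_times_exp_tendsto_0 filterlim_inverse_at_top_right])
    moreover have "\<forall>\<^sub>F h in at_right 0. poly (P * [:0, 1:]) (inverse h) * exp (- (inverse h)) = flat P h / h"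
      unfolding eventually_at_right_field
      by (intro exI [of _ 1]) (auto simp: flat_def divide_simps)
    ultimately show ?thesis by (rule Lim_transform_eventually)
  qed
  ultimately have "((\<lambda>h. flat P h / h) \<longlongrightarrow> 0) (at 0)"
    by (simp add: filterlim_split_at)
  then show ?thesis using equal by (simp add: DERIV_def flat_def)
qed

primrec flat_poly :: "nat \<Rightarrow> real poly" where
  "flat_poly 0 = 1"
| "flat_poly (Suc k) = (flat_poly k - pderiv (flat_poly k)) * [:0, 0, 1:]"

text \<open>
  The normalising factor \<open>exp 2\<close> makes each factor equal to \<open>1\<close> at the origin.
\<close>

definition cutoff :: "nat \<Rightarrow> real \<Rightarrow> (nat \<Rightarrow> real) \<Rightarrow> real" where
  "cutoff d R x = (\<Prod>i<d. exp 2 * flat 1 (1 - x i / R) * flat 1 (1 + x i / R))"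

lemma flat_1: "flat 1 x = (if 0 < x then exp (- 1 / x) else 0)"
  by (simp add: flat_def)

lemma cutoff_factor_bounds:
  "0 \<le> exp 2 * flat 1 (1 - s) * flat 1 (1 + s)" "exp 2 * flat 1 (1 - s) * flat 1 (1 + s) \<le> 1"
proof -
  have "exp 2 * exp (- 1 / (1 - s)) * exp (- 1 / (1 + s)) \<le> 1" if "0 < 1 - s" "0 < 1 + s"
  proof -
    have "0 < (1 - s) * (1 + s)" using that by simp
    then have "2 + (- 1 / (1 - s)) + (- 1 / (1 + s)) \<le> 0"
      using that by (simp add: divide_simps) (simp add: algebra_simps)
    then show ?thesis by (simp flip: exp_add)
  qed
  then show "exp 2 * flat 1 (1 - s) * flat 1 (1 + s) \<le> 1"
    by (auto simp: flat_1)
qed (simp add: flat_1)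

lemma cutoff_bounds: "0 \<le> cutoff d R x" "cutoff d R x \<le> 1"
  unfolding cutoff_def using cutoff_factor_bounds
  by (auto intro!: prod_nonneg prod_le_1)

lemma cutoff_eq_0:
  assumes "i < d" "R < \<bar>x i\<bar>" "0 < R"
  shows "cutoff d R x = 0"
proof -
  have "1 < x i / R \<or> x i / R < - 1"
    using assms by (auto simp: field_simps abs_if split: if_splits)
  then show ?thesis
    unfolding cutoff_def using assms(1) by (intro prod_zero) (auto simp: flat_1 intro!: bexI [of _ i])
qed

lemma cutoff_tendsto_1: "(\<lambda>n. cutoff d (real (Suc n)) x) \<longlonglongrightarrow> 1"
proof -
  have flat: "(\<lambda>n. flat 1 (1 + c * (x i / real (Suc n)))) \<longlonglongrightarrow> exp (- 1)" for i c
  proof -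
    have "(\<lambda>n. x i * inverse (real (Suc n))) \<longlonglongrightarrow> x i * 0"
      by (intro tendsto_mult tendsto_const LIMSEQ_inverse_real_of_nat)
    from tendsto_add [OF tendsto_const [of 1] tendsto_mult [OF tendsto_const [of c] this]]
    have "(\<lambda>n. 1 + c * (x i / real (Suc n))) \<longlonglongrightarrow> 1 + c * (x i * 0)"
      unfolding divide_inverse .
    then show ?thesis
      using isCont_tendsto_compose [OF DERIV_isCont [OF flat_has_derivative [of 1 1]]]
      by (simp add: flat_1)
  qed
  have "(\<lambda>n. cutoff d (real (Suc n)) x) \<longlonglongrightarrow> (\<Prod>i<d. exp 2 * exp (- 1) * exp (- 1))"
    unfolding cutoff_def using flat [of "- 1"] flat [of 1]
    by (intro tendsto_prod tendsto_mult tendsto_const) auto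
  then show ?thesis by (simp flip: exp_add)
qed

lemma Ck_cutoff: "Ck d n (\<lambda>x. of_real (cutoff d R x))"
proof -
  have D: "(flat (flat_poly k) has_real_derivative flat (flat_poly (Suc k)) s) (at s)" for k s
    using flat_has_derivative by simp
  have "Ck d n (\<lambda>x. \<Prod>i<d. of_real (exp 2 * flat (flat_poly 0) (1 + (- 1 / R) * x i)) *
      of_real (1 * flat (flat_poly 0) (1 + (1 / R) * x i)))"
    by (intro Ck_prod Ck_mult Ck_coordinate D) auto
  then show ?thesis
    by (simp add: cutoff_def)
qed

text \<open>
  Tychonoff's theorem: as a subset of the space of all functions, the box is the product of compact
  intervals and, beyond the dimension, of one-point sets.
\<close>

lemma compact_box: "compact {x \<in> Rn d. \<forall>i<d. \<bar>x i\<bar> \<le> R}"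
proof -
  let ?B = "\<lambda>i. if i < d then {- R..R} else {undefined :: real}"
  have "compactin (product_topology (\<lambda>_. euclidean) UNIV) (PiE UNIV ?B)"
    unfolding compactin_PiE by auto
  then have "compact (PiE UNIV ?B)" by (simp add: euclidean_product_topology)
  also have "PiE UNIV ?B = {x \<in> Rn d. \<forall>i<d. \<bar>x i\<bar> \<le> R}"
    by (auto simp: Rn_def PiE_def Pi_def extensional_def abs_le_iff minus_le_iff split: if_splits)
  finally show ?thesis .
qed

text \<open>
  The set on which \<open>g\<close> is known to vanish is relatively open, so partial derivatives vanish on it as well.
\<close>

lemma foldr_pdiff_support:
  assumes "\<And>x. x \<in> Rn d \<Longrightarrow> (\<exists>i<d. R < \<bar>x i\<bar>) \<Longrightarrow> g x = 0"
    and "set js \<subseteq> {..<d}" "x \<in> Rn d" "\<exists>i<d. R < \<bar>x i\<bar>"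
  shows "foldr pdiff js g x = 0"
  using assms(2-)
proof (induction js arbitrary: x)
  case Nil
  then show ?case using assms(1) by simp
next
  case (Cons j js)
  let ?h = "foldr pdiff js g"
  from Cons.prems obtain i where i: "i < d" "R < \<bar>x i\<bar>" and j: "j < d" by auto
  have "\<forall>\<^sub>F s in nhds (x j). ?h (x(j := s)) = 0"
  proof (cases "i = j")
    case True
    have "open {s::real. R < \<bar>s\<bar>}" by (intro open_Collect_less continuous_intros)
    then have "\<forall>\<^sub>F s in nhds (x j). s \<in> {s. R < \<bar>s\<bar>}"
      using i True by (intro eventually_nhds_in_open) auto
    moreover have "?h (x(j := s)) = 0" if "R < \<bar>s\<bar>" for s
      using Cons.prems j that
      by (intro Cons.IH exI [of _ j]) (auto simp del: fun_upd_apply simp: fun_upd_same)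
    ultimately show ?thesis by (auto elim!: eventually_mono)
  next
    case False
    have "?h (x(j := s)) = 0" for s
      using Cons.prems i j False
      by (intro Cons.IH exI [of _ i]) (auto simp del: fun_upd_apply simp: fun_upd_other)
    then show ?thesis by simp
  qed
  then have "((\<lambda>s. ?h (x(j := s))) has_vector_derivative 0) (at (x j)) \<longleftrightarrow>
      ((\<lambda>s. 0::complex) has_vector_derivative 0) (at (x j))"
    by (intro has_vector_derivative_cong_ev) (auto dest: eventually_nhds_x_imp_x)
  then have "pdiff j ?h x = 0"
    unfolding pdiff_def by (intro vector_derivative_at) simp
  then show ?case by simp
qed

lemma schwartz_if_compact_support:
  assumes "smoothn d g" and supp: "\<And>x. x \<in> Rn d \<Longrightarrow> (\<exists>i<d. R < \<bar>x i\<bar>) \<Longrightarrow> g x = 0"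
  shows "schwartz d g"
  unfolding schwartz_def
proof (intro conjI allI impI)
  fix js N assume js: "set js \<subseteq> {..<d}"
  let ?B = "{x \<in> Rn d. \<forall>i<d. \<bar>x i\<bar> \<le> R}"
  let ?h = "\<lambda>x. (1 + normn d x) ^ N * norm (foldr pdiff js g x)"
  have "continuous_on (Rn d) (foldr pdiff js g)"
    using assms(1) js unfolding smoothn_def by blast
  then have "continuous_on ?B ?h"
    by (intro continuous_intros continuous_on_normn) (auto intro: continuous_on_subset)
  then have "bounded (?h ` ?B)"
    by (intro compact_imp_bounded compact_continuous_image compact_box)
  then obtain B where B: "\<And>x. x \<in> ?B \<Longrightarrow> ?h x \<le> B" and "0 < B"
    unfolding bounded_pos by (auto simp: abs_le_iff)
  have "?h x \<le> B" if "x \<in> Rn d" for x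
  proof (cases "x \<in> ?B")
    case False
    then have "\<exists>i<d. R < \<bar>x i\<bar>" using that by (auto simp: not_le)
    then have "foldr pdiff js g x = 0" using supp js that by (intro foldr_pdiff_support) auto
    then show ?thesis using \<open>0 < B\<close> by simp
  qed (rule B)
  then show "\<exists>B. \<forall>x\<in>Rn d. ?h x \<le> B" by blast
qed (rule assms(1))

section \<open>Increments of the multiplier along rays\<close>
lemma normn_nonneg [simp]: "0 \<le> normn d x"
  by (simp add: normn_def L2_set_nonneg)

lemma normn_scalen: "normn d (scalen d t x) = \<bar>t\<bar> * normn d x"
proof -
  have "L2_set (\<lambda>i. \<bar>t\<bar> * x i) {..<d} = \<bar>t\<bar> * L2_set x {..<d}"
    by (simp add: L2_set_right_distrib)
  moreover have "L2_set (scalen d t x) {..<d} = L2_set (\<lambda>i. \<bar>t\<bar> * x i) {..<d}"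
    by (simp add: L2_set_def scalen_def power_mult_distrib)
  ultimately show ?thesis by (simp add: normn_def)
qed

text \<open>
  The chain rule from continuous partial derivatives. The point \<open>scalen d s z\<close> is moved one coordinate
  at a time: \<open>path k s\<close> has its first \<open>k\<close> coordinates at time \<open>s\<close> and the others at time \<open>u\<close>. Going from
  \<open>k\<close> to \<open>k + 1\<close> is the chain rule for a function of two real variables, the time of the earlier
  coordinates and the new coordinate.
\<close>

lemma ray_derivative:
  assumes g: "Ck d 1 g"
  shows "((\<lambda>s. g (scalen d s z)) has_vector_derivative
      (\<Sum>i<d. of_real (z i) * pdiff i g (scalen d u z))) (at u)"
proof -
  define path where "path k s = (\<lambda>i\<in>{..<d}. if i < k then s * z i else u * z i)" for k s
  have path_Rn: "path k s \<in> Rn d" for k s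
    by (auto simp: path_def Rn_def)
  have path_u: "path k u = scalen d u z" for k
    by (auto simp: path_def scalen_def fun_eq_iff)
  have path_Suc: "path (Suc k) s = (path k s)(k := s * z k)" if "k < d" for k s
    using that by (auto simp: path_def fun_eq_iff restrict_def)
  have path_triv: "(path k s)(k := u * z k) = path k s" if "k < d" for k s
    using that by (auto simp: path_def fun_eq_iff restrict_def)
  have "((\<lambda>s. g (path k s)) has_vector_derivative
      (\<Sum>i<k. of_real (z i) * pdiff i g (scalen d u z))) (at u)" if "k \<le> d" for k
    using that
  proof (induction k)
    case 0
    have "path 0 s = scalen d u z" for s
      by (auto simp: path_def scalen_def fun_eq_iff)
    then show ?case by simp
  next
    case (Suc k)
    then have k: "k < d" by simp
    define p where "p s y = (path k s)(k := y)" for s y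
    have p_Rn: "p s y \<in> Rn d" for s y using path_Rn k by (simp add: p_def del: fun_upd_apply)
    let ?G = "\<lambda>s y. pdiff k g (p s y)"
    have p_cont: "continuous_on A (\<lambda>(s, y). p s y)" for A
      unfolding case_prod_beta
    proof (rule continuous_on_coordinatewise_then_product)
      fix i
      show "continuous_on A (\<lambda>x. p (fst x) (snd x) i)"
        by (cases "i = k"; cases "i < k"; cases "i < d")
          (auto simp: p_def path_def intro!: continuous_intros)
    qed
    have G_cont: "continuous_on UNIV (\<lambda>(s, y). ?G s y)"
      using continuous_on_compose2 [of "Rn d" "pdiff k g" UNIV "\<lambda>(s, y). p s y"] p_cont g k p_Rn
      by (auto simp: case_prod_beta)
    have "((\<lambda>(s, y). g (p s y)) has_derivative
        (\<lambda>(ts, ty). ts *\<^sub>R (\<Sum>i<k. of_real (z i) * pdiff i g (scalen d u z))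
           + blinfun_apply (blinfun_scaleR_left (?G u (u * z k))) ty)) (at (u, u * z k) within UNIV \<times> UNIV)"
    proof (rule has_derivative_partialsI)
      show "((\<lambda>s. g (p s (u * z k))) has_derivative
          (\<lambda>ts. ts *\<^sub>R (\<Sum>i<k. of_real (z i) * pdiff i g (scalen d u z)))) (at u within UNIV)"
        using Suc k by (simp add: p_def path_triv has_vector_derivative_def del: fun_upd_apply)
      show "((\<lambda>y. g (p s y)) has_derivative blinfun_apply (blinfun_scaleR_left (?G s y))) (at y within UNIV)" for s y
        using Ck_has_vector_derivative [of d 0 g k "p s y"] g k p_Rn [of s y]
        by (simp add: has_vector_derivative_def p_def)
      have "continuous (at (u, u * z k)) (\<lambda>x. blinfun_scaleR_left ((\<lambda>(s, y). ?G s y) x))"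
        using G_cont by (intro bounded_linear.continuous [OF bounded_linear_blinfun_scaleR_left])
          (simp add: continuous_on_eq_continuous_at)
      then show "continuous (at (u, u * z k) within UNIV \<times> UNIV) (\<lambda>(s, y). blinfun_scaleR_left (?G s y))"
        by (simp add: case_prod_unfold)
    qed auto
    then have "((\<lambda>(s, y). g (p s y)) has_derivative
        (\<lambda>(ts, ty). ts *\<^sub>R (\<Sum>i<k. of_real (z i) * pdiff i g (scalen d u z))
           + ty *\<^sub>R ?G u (u * z k))) (at (u, u * z k))"
      by simp
    moreover have "((\<lambda>s. (s, s * z k)) has_derivative (\<lambda>ts. (ts, ts * z k))) (at u)"
      by (auto intro!: derivative_eq_intros)
    ultimately have "((\<lambda>s. (\<lambda>(s, y). g (p s y)) (s, s * z k)) has_derivative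
        (\<lambda>ts. (\<lambda>(ts, ty). ts *\<^sub>R (\<Sum>i<k. of_real (z i) * pdiff i g (scalen d u z))
           + ty *\<^sub>R ?G u (u * z k)) (ts, ts * z k))) (at u)"
      by (rule has_derivative_compose [rotated])
    then have "((\<lambda>s. g (path (Suc k) s)) has_derivative
        (\<lambda>ts. ts *\<^sub>R (\<Sum>i<k. of_real (z i) * pdiff i g (scalen d u z))
           + (ts * z k) *\<^sub>R ?G u (u * z k))) (at u)"
      by (simp add: path_Suc k p_def del: fun_upd_apply)
    moreover have "p u (u * z k) = scalen d u z"
      using path_triv [OF k, of u] by (simp add: p_def path_u del: fun_upd_apply)
    ultimately show ?case
      by (simp add: has_vector_derivative_def scaleR_conv_of_real algebra_simps)
  qed
  from this [of d] have "((\<lambda>s. g (path d s)) has_vector_derivative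
      (\<Sum>i<d. of_real (z i) * pdiff i g (scalen d u z))) (at u)" by simp
  moreover have "path d s = scalen d s z" for s
    by (auto simp: path_def scalen_def fun_eq_iff restrict_def)
  ultimately show ?thesis by simp
qed

text \<open>
  Up to the factor \<open>D / \<eta>\<close>, this is the integral over \<open>[0, t]\<close> of the bound
  \<open>D \<bar>z\<bar> (1 + s\<bar>z\<bar>) powr (- 1 - \<eta>)\<close> for the speed of the multiplier along the ray through \<open>z\<close>.
\<close>

definition radial_profile :: "nat \<Rightarrow> real \<Rightarrow> real \<Rightarrow> (nat \<Rightarrow> real) \<Rightarrow> real" where
  "radial_profile d \<eta> t z = 1 - (1 + t * normn d z) powr (- \<eta>)"

lemma radial_profile_0 [simp]: "radial_profile d \<eta> 0 z = 0"
  by (simp add: radial_profile_def)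

lemma radial_profile_mono:
  assumes "0 < \<eta>" "0 \<le> s" "s \<le> t"
  shows "radial_profile d \<eta> s z \<le> radial_profile d \<eta> t z"
  unfolding radial_profile_def using assms
  by (intro diff_left_mono powr_mono2' add_left_mono mult_right_mono) (auto intro: add_pos_nonneg)

lemma radial_profile_bounds:
  assumes "0 < \<eta>" "0 \<le> t"
  shows "0 \<le> radial_profile d \<eta> t z" "radial_profile d \<eta> t z \<le> 1"
  using radial_profile_mono [of \<eta> 0 t d z] assms by (auto simp: radial_profile_def)

text \<open>
  The mean value inequality along the ray through \<open>- z\<close>: by Cauchy-Schwarz the derivative is at most the
  length of \<open>z\<close> times the gradient, that is, at most the derivative of the majorant on the right.
\<close>

lemma radial_increment_le:
  assumes g: "Ck d 1 g" and D: "0 \<le> D" and \<eta>: "0 < \<eta>"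
    and grad: "\<And>x. x \<in> Rn d \<Longrightarrow> grad_norm d g x \<le> D * (1 + normn d x) powr (- 1 - \<eta>)"
    and st: "0 \<le> s" "s \<le> t"
  shows "norm (g (scalen d (- t) z) - g (scalen d (- s) z))
    \<le> D / \<eta> * (radial_profile d \<eta> t z - radial_profile d \<eta> s z)"
proof (cases "s = t")
  case False
  then have "s < t" using st by simp
  define w where "w = scalen d (- 1) z"
  have w: "scalen d (- u) z = scalen d u w" for u
    by (auto simp: w_def scalen_def fun_eq_iff)
  have normw: "normn d w = normn d z" by (simp add: w_def normn_scalen)
  let ?f' = "\<lambda>u. \<Sum>i<d. of_real (w i) * pdiff i g (scalen d u w)"
  let ?\<phi> = "\<lambda>u. D / \<eta> * radial_profile d \<eta> u w"
  let ?\<phi>' = "\<lambda>u. D * normn d w * (1 + u * normn d w) powr (- 1 - \<eta>)"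
  have f': "((\<lambda>u. g (scalen d u w)) has_vector_derivative ?f' u) (at u)" for u
    by (rule ray_derivative [OF g])
  have \<phi>': "(?\<phi> has_real_derivative ?\<phi>' u) (at u)" if "0 \<le> u" for u
  proof -
    have "0 < 1 + u * normn d w" using that by (simp add: add_pos_nonneg)
    from DERIV_chain2 [where g = "\<lambda>u. 1 + u * normn d w", OF has_real_derivative_powr [OF this, of "- \<eta>"]]
    have "((\<lambda>u. (1 + u * normn d w) powr (- \<eta>)) has_real_derivative
        - \<eta> * (1 + u * normn d w) powr (- \<eta> - 1) * normn d w) (at u)"
      by (rule meta_mp) (auto intro!: derivative_eq_intros)
    from DERIV_cmult [OF DERIV_diff [OF DERIV_const this, of 1], of "D / \<eta>"]
    have "(?\<phi> has_real_derivative
        D / \<eta> * (0 - (- \<eta> * (1 + u * normn d w) powr (- \<eta> - 1) * normn d w))) (at u)"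
      unfolding radial_profile_def .
    moreover have "- \<eta> - 1 = - 1 - \<eta>" by simp
    ultimately show ?thesis using \<eta> by (simp add: mult_ac)
  qed
  have "norm (g (scalen d t w) - g (scalen d s w)) \<le> ?\<phi> t - ?\<phi> s"
  proof (rule differentiable_bound_general [OF \<open>s < t\<close>, where f' = ?f' and \<phi>' = ?\<phi>'])
    show "continuous_on {s..t} (\<lambda>u. g (scalen d u w))"
      using f' by (intro continuous_at_imp_continuous_on ballI) (rule has_vector_derivative_continuous)
    show "continuous_on {s..t} ?\<phi>"
    proof (intro continuous_at_imp_continuous_on ballI)
      fix u assume "u \<in> {s..t}"
      then show "isCont ?\<phi> u" using st by (intro DERIV_isCont [OF \<phi>']) auto
    qed
    fix u assume u: "s < u" "u < t"
    show "(?\<phi> has_vector_derivative ?\<phi>' u) (at u)"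
      using \<phi>' [of u] u st by (simp add: has_real_derivative_iff_has_vector_derivative)
    have "norm (?f' u) \<le> (\<Sum>i<d. \<bar>w i\<bar> * \<bar>norm (pdiff i g (scalen d u w))\<bar>)"
      by (rule order_trans [OF norm_sum]) (simp add: norm_mult)
    also have "\<dots> \<le> normn d w * grad_norm d g (scalen d u w)"
      unfolding normn_def grad_norm_def by (rule L2_set_mult_ineq)
    also have "\<dots> \<le> normn d w * (D * (1 + normn d (scalen d u w)) powr (- 1 - \<eta>))"
      by (intro mult_left_mono grad) auto
    also have "\<dots> = ?\<phi>' u" using u st by (simp add: normn_scalen)
    finally show "norm (?f' u) \<le> ?\<phi>' u" .
  qed (rule f')
  then show ?thesis by (simp add: w radial_profile_def normw right_diff_distrib)
qed simp

section \<open>Positive parts of signed measures\<close>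

text \<open>
  The real counterpart of \<open>complex_measure\<close>, satisfied by the real and imaginary parts.
\<close>

definition signed_measure :: "'a measure \<Rightarrow> ('a set \<Rightarrow> real) \<Rightarrow> bool" where
  "signed_measure M \<nu> \<longleftrightarrow> \<nu> {} = 0 \<and>
     (\<forall>E :: nat \<Rightarrow> 'a set. range E \<subseteq> sets M \<longrightarrow> disjoint_family E \<longrightarrow>
        (\<lambda>n. \<nu> (E n)) sums \<nu> (\<Union>n. E n))"

lemma signed_measure_sums:
  assumes "signed_measure M \<nu>" "range E \<subseteq> sets M" "disjoint_family E"
  shows "(\<lambda>n. \<nu> (E n)) sums \<nu> (\<Union>n. E n)"
  using assms unfolding signed_measure_def by blast

lemma signed_measure_Un:
  assumes \<nu>: "signed_measure M \<nu>" and "A \<in> sets M" "B \<in> sets M" "A \<inter> B = {}"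
  shows "\<nu> (A \<union> B) = \<nu> A + \<nu> B"
proof -
  have "(\<lambda>n. \<nu> (binaryset A B n)) sums \<nu> (\<Union>n. binaryset A B n)"
    by (rule signed_measure_sums [OF \<nu>])
      (use assms in \<open>auto simp: binaryset_def disjoint_family_on_def\<close>)
  moreover have "(\<lambda>n. \<nu> (binaryset A B n)) sums (\<nu> A + \<nu> B)"
    by (rule binaryset_sums) (use \<nu> in \<open>simp add: signed_measure_def\<close>)
  ultimately show ?thesis by (auto simp: UN_binaryset_eq intro: sums_unique2)
qed

lemma signed_measure_Diff:
  assumes \<nu>: "signed_measure M \<nu>" and "A \<in> sets M" "B \<in> sets M" "B \<subseteq> A"
  shows "\<nu> (A - B) = \<nu> A - \<nu> B"
  using signed_measure_Un [OF \<nu>, of B "A - B"] assms by (simp add: Un_absorb1)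

text \<open>
  The positive part is finite for the following reason. Call a set wild if the values of \<open>\<nu>\<close> on its
  subsets are unbounded. A wild set contains a part of absolute value at least \<open>1\<close> whose remainder is
  still wild: some subset has a value so large that both it and its complement have absolute value
  at least \<open>1\<close>, and one of the two is wild. If the whole space were wild, iteration would produce
  disjoint sets whose values are not summable, contradicting countable additivity.
\<close>

lemma signed_measure_bounded:
  assumes \<nu>: "signed_measure M \<nu>"
  obtains B where "\<And>F. F \<in> sets M \<Longrightarrow> \<nu> F \<le> B"
proof -
  define wild where "wild E \<longleftrightarrow> (\<forall>B. \<exists>F\<in>sets M. F \<subseteq> E \<and> B < \<bar>\<nu> F\<bar>)" for E
  have split: "wild A \<or> wild (E - A)" if E: "wild E" "A \<in> sets M" "A \<subseteq> E" for E A
  proof (rule ccontr)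
    assume "\<not> ?thesis"
    then obtain B1 B2 where B: "\<And>F. F \<in> sets M \<Longrightarrow> F \<subseteq> A \<Longrightarrow> \<bar>\<nu> F\<bar> \<le> B1"
        "\<And>F. F \<in> sets M \<Longrightarrow> F \<subseteq> E - A \<Longrightarrow> \<bar>\<nu> F\<bar> \<le> B2"
      unfolding wild_def de_Morgan_disj by (metis not_less)
    obtain F where F: "F \<in> sets M" "F \<subseteq> E" "B1 + B2 < \<bar>\<nu> F\<bar>"
      using E(1) unfolding wild_def by blast
    have "F \<inter> A \<inter> (F - A) = {}" by blast
    then have "\<nu> F = \<nu> (F \<inter> A) + \<nu> (F - A)"
      using signed_measure_Un [OF \<nu>, of "F \<inter> A" "F - A"] F E(2) by (simp add: Int_Diff_Un)
    moreover have "\<bar>\<nu> (F \<inter> A)\<bar> \<le> B1" "\<bar>\<nu> (F - A)\<bar> \<le> B2"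
      using F E(2) by (auto intro!: B)
    ultimately show False using F(3) by linarith
  qed
  have step: "\<exists>A. A \<in> sets M \<and> A \<subseteq> E \<and> 1 \<le> \<bar>\<nu> A\<bar> \<and> wild (E - A)" if E: "E \<in> sets M" "wild E" for E
  proof -
    obtain F where F: "F \<in> sets M" "F \<subseteq> E" "\<bar>\<nu> E\<bar> + 1 < \<bar>\<nu> F\<bar>"
      using E(2) unfolding wild_def by blast
    have "\<nu> (E - F) = \<nu> E - \<nu> F" by (rule signed_measure_Diff [OF \<nu> E(1) F(1,2)])
    then have "1 \<le> \<bar>\<nu> F\<bar>" "1 \<le> \<bar>\<nu> (E - F)\<bar>" using F(3) by linarith+
    moreover have "E - (E - F) = F" using F(2) by blast
    ultimately show ?thesis
      using split [OF E(2) F(1,2)] E(1) F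
      by (metis Diff_subset sets.Diff)
  qed
  have "\<not> wild (space M)"
  proof
    assume wild: "wild (space M)"
    define pick where "pick E = (SOME A. A \<in> sets M \<and> A \<subseteq> E \<and> 1 \<le> \<bar>\<nu> A\<bar> \<and> wild (E - A))" for E
    have pick: "pick E \<in> sets M \<and> pick E \<subseteq> E \<and> 1 \<le> \<bar>\<nu> (pick E)\<bar> \<and> wild (E - pick E)"
      if "E \<in> sets M" "wild E" for E
      unfolding pick_def by (rule someI_ex) (rule step [OF that])
    define R where "R n = ((\<lambda>E. E - pick E) ^^ n) (space M)" for n
    have R: "R n \<in> sets M \<and> wild (R n)" for n
      by (induction n) (use wild pick in \<open>auto simp: R_def\<close>)
    have R_Suc: "R (Suc n) = R n - pick (R n)" for n by (simp add: R_def)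
    have R_anti: "R n \<subseteq> R m" if "m \<le> n" for m n
      using that by (induction rule: dec_induct) (auto simp: R_Suc)
    have "pick (R m) \<inter> pick (R n) = {}" if "m < n" for m n
    proof -
      have "pick (R n) \<subseteq> R n" using pick R by simp
      also have "R n \<subseteq> R m - pick (R m)" using R_anti [of "Suc m" n] that R_Suc [of m] by simp
      finally show ?thesis by blast
    qed
    then have "disjoint_family (\<lambda>n. pick (R n))"
      unfolding disjoint_family_on_def by (metis Int_commute linorder_neqE_nat)
    moreover have "range (\<lambda>n. pick (R n)) \<subseteq> sets M" using pick R by auto
    ultimately have "summable (\<lambda>n. \<nu> (pick (R n)))"
      using signed_measure_sums [OF \<nu>] sums_summable by blast
    then have "(\<lambda>n. \<bar>\<nu> (pick (R n))\<bar>) \<longlonglongrightarrow> 0"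
      using summable_LIMSEQ_zero tendsto_rabs_zero by blast
    then have "\<forall>\<^sub>F n in sequentially. \<bar>\<nu> (pick (R n))\<bar> < 1"
      by (rule order_tendstoD) simp
    then show False using pick R by (auto simp: eventually_sequentially not_le[symmetric])
  qed
  then obtain B where "\<And>F. F \<in> sets M \<Longrightarrow> F \<subseteq> space M \<Longrightarrow> \<bar>\<nu> F\<bar> \<le> B"
    unfolding wild_def by (metis not_less)
  then show thesis
    using that [of B] sets.sets_into_space [of _ M] by (meson abs_le_D1)
qed

lemma space_jordan_pos [simp]: "space (jordan_pos M \<nu>) = space M"
  by (simp add: jordan_pos_def space_measure_of sets.space_closed)

lemma sets_jordan_pos [simp, measurable_cong]: "sets (jordan_pos M \<nu>) = sets M"
  by (simp add: jordan_pos_def sets.sigma_sets_eq sets.space_closed)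

text \<open>
  A measure given by \<open>measure_of\<close> has the prescribed values only if these are countably
  additive. Superadditivity of the supremum holds for two, hence for finitely many sets, because near
  optimal subsets can be united; negative values are first replaced by that of the empty set, for which
  the truncation in \<open>ennreal\<close> is additive. Subadditivity holds since \<open>\<nu> F\<close> is the sum of the \<open>\<nu> (F \<inter> A i)\<close>.
\<close>

lemma emeasure_jordan_pos:
  assumes \<nu>: "signed_measure M \<nu>" and "E \<in> sets M"
  shows "emeasure (jordan_pos M \<nu>) E = (SUP F\<in>{F \<in> sets M. F \<subseteq> E}. ennreal (\<nu> F))"
proof -
  define P where "P E = (SUP F\<in>{F \<in> sets M. F \<subseteq> E}. ennreal (\<nu> F))" for E
  have \<nu>0: "\<nu> {} = 0" using \<nu> by (simp add: signed_measure_def)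
  have upper: "ennreal (\<nu> F) \<le> P E" if "F \<in> sets M" "F \<subseteq> E" for F E
    unfolding P_def by (rule SUP_upper) (use that in auto)
  have mono: "P A \<le> P B" if "A \<subseteq> B" for A B
    unfolding P_def by (rule SUP_subset_mono) (use that in auto)
  have pair: "ennreal (\<nu> F) + ennreal (\<nu> G) \<le> P (A \<union> B)"
    if "F \<in> sets M" "F \<subseteq> A" "G \<in> sets M" "G \<subseteq> B" "A \<inter> B = {}" for F G A B
  proof -
    \<comment> \<open>Replacing sets of negative value by the empty set changes neither term.\<close>
    define F' where "F' = (if 0 \<le> \<nu> F then F else {})"
    define G' where "G' = (if 0 \<le> \<nu> G then G else {})"
    have "ennreal (\<nu> F) = ennreal (\<nu> F')" "0 \<le> \<nu> F'" "F' \<in> sets M" "F' \<subseteq> A"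
      using that \<nu>0 by (auto simp: F'_def ennreal_neg)
    moreover have "ennreal (\<nu> G) = ennreal (\<nu> G')" "0 \<le> \<nu> G'" "G' \<in> sets M" "G' \<subseteq> B"
      using that \<nu>0 by (auto simp: G'_def ennreal_neg)
    moreover have "\<nu> (F' \<union> G') = \<nu> F' + \<nu> G'"
      using calculation that(5) by (intro signed_measure_Un [OF \<nu>]) auto
    ultimately show ?thesis
      using upper [of "F' \<union> G'" "A \<union> B"] by (simp add: ennreal_plus [symmetric] del: ennreal_plus) blast
  qed
  have superadd: "P A + P B \<le> P (A \<union> B)" if "A \<inter> B = {}" for A B
  proof -
    have ne: "{F \<in> sets M. F \<subseteq> X} \<noteq> {}" for X by auto
    have "P A + P B = (SUP F\<in>{F \<in> sets M. F \<subseteq> A}. ennreal (\<nu> F) + P B)"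
      unfolding P_def [of A] by (rule ennreal_SUP_add_left [OF ne, symmetric])
    also have "\<dots> = (SUP F\<in>{F \<in> sets M. F \<subseteq> A}. SUP G\<in>{G \<in> sets M. G \<subseteq> B}. ennreal (\<nu> F) + ennreal (\<nu> G))"
      unfolding P_def [of B] by (intro SUP_cong refl ennreal_SUP_add_right [OF ne])
    also have "\<dots> \<le> P (A \<union> B)" by (intro SUP_least pair) (use that in auto)
    finally show ?thesis .
  qed
  have "countably_additive (sets M) P"
  proof (rule countably_additiveI)
    fix A :: "nat \<Rightarrow> 'a set"
    assume A: "range A \<subseteq> sets M" "disjoint_family A" "(\<Union>i. A i) \<in> sets M"
    show "(\<Sum>i. P (A i)) = P (\<Union>i. A i)"
    proof (rule antisym)
      have "(\<Sum>i<n. P (A i)) \<le> P (\<Union>i<n. A i)" for n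
      proof (induction n)
        case (Suc n)
        have "(\<Union>i<n. A i) \<inter> A n = {}"
          using A(2) unfolding disjoint_family_on_def by (blast dest: less_imp_neq)
        from superadd [OF this] have "P (\<Union>i<n. A i) + P (A n) \<le> P (\<Union>i<Suc n. A i)"
          by (simp add: lessThan_Suc Un_commute)
        have "(\<Sum>i<Suc n. P (A i)) \<le> P (\<Union>i<n. A i) + P (A n)"
          using Suc by (simp add: add_right_mono)
        also note \<open>P (\<Union>i<n. A i) + P (A n) \<le> P (\<Union>i<Suc n. A i)\<close>
        finally show ?case .
      qed simp
      also have "P (\<Union>i<n. A i) \<le> P (\<Union>i. A i)" for n by (rule mono) auto
      finally show "(\<Sum>i. P (A i)) \<le> P (\<Union>i. A i)" by (intro suminf_le_const) auto
      show "P (\<Union>i. A i) \<le> (\<Sum>i. P (A i))"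
        unfolding P_def [of "\<Union>i. A i"]
      proof (rule SUP_least)
        fix F assume F: "F \<in> {F \<in> sets M. F \<subseteq> (\<Union>i. A i)}"
        have "(\<lambda>i. \<nu> (F \<inter> A i)) sums \<nu> (\<Union>i. F \<inter> A i)"
          by (rule signed_measure_sums [OF \<nu>]) (use A F in \<open>auto simp: disjoint_family_on_def\<close>)
        moreover have "(\<Union>i. F \<inter> A i) = F" using F by auto
        ultimately have "(\<lambda>n. ennreal (\<Sum>i<n. \<nu> (F \<inter> A i))) \<longlonglongrightarrow> ennreal (\<nu> F)"
          unfolding sums_def by (intro tendsto_ennrealI) simp
        moreover have "ennreal (\<Sum>i<n. \<nu> (F \<inter> A i)) \<le> (\<Sum>i. P (A i))" for n
        proof -
          have "(\<Sum>i<n. \<nu> (F \<inter> A i)) \<le> (\<Sum>i<n. max 0 (\<nu> (F \<inter> A i)))" by (rule sum_mono) simp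
          then have "ennreal (\<Sum>i<n. \<nu> (F \<inter> A i)) \<le> (\<Sum>i<n. ennreal (max 0 (\<nu> (F \<inter> A i))))"
            by (simp add: ennreal_leI sum_nonneg)
          also have "\<dots> \<le> (\<Sum>i<n. P (A i))"
          proof (rule sum_mono)
            fix i
            have "ennreal (max 0 (\<nu> (F \<inter> A i))) = ennreal (\<nu> (F \<inter> A i))" by (simp add: max_def ennreal_neg)
            also have "\<dots> \<le> P (A i)" using F A by (intro upper) auto
            finally show "ennreal (max 0 (\<nu> (F \<inter> A i))) \<le> P (A i)" .
          qed
          also have "\<dots> \<le> (\<Sum>i. P (A i))" by (rule sum_le_suminf) auto
          finally show ?thesis .
        qed
        ultimately show "ennreal (\<nu> F) \<le> (\<Sum>i. P (A i))" by (intro LIMSEQ_le_const2) auto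
      qed
    qed
  qed
  moreover have "positive (sets M) P" by (simp add: positive_def P_def \<nu>0)
  moreover have "jordan_pos M \<nu> = measure_of (space M) (sets M) P"
    unfolding jordan_pos_def P_def [abs_def] ..
  ultimately have "emeasure (jordan_pos M \<nu>) E = P E"
    using assms(2) by (intro emeasure_measure_of [OF _ sets.space_closed]) auto
  then show ?thesis by (simp only: P_def)
qed

lemma finite_measure_jordan_pos:
  assumes \<nu>: "signed_measure M \<nu>"
  shows "finite_measure (jordan_pos M \<nu>)"
proof (rule finite_measureI)
  obtain B where B: "\<And>F. F \<in> sets M \<Longrightarrow> \<nu> F \<le> B" using signed_measure_bounded [OF \<nu>] by blast
  have "emeasure (jordan_pos M \<nu>) (space M) \<le> ennreal B"
    unfolding emeasure_jordan_pos [OF \<nu> sets.top] by (rule SUP_least) (auto intro: ennreal_leI B)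
  then show "emeasure (jordan_pos M \<nu>) (space (jordan_pos M \<nu>)) \<noteq> \<infinity>"
    by (auto simp: top_unique)
qed

lemma complex_measure_signed:
  assumes "complex_measure M \<mu>"
  shows "signed_measure M (\<lambda>E. Re (\<mu> E))" "signed_measure M (\<lambda>E. - Re (\<mu> E))"
    "signed_measure M (\<lambda>E. Im (\<mu> E))" "signed_measure M (\<lambda>E. - Im (\<mu> E))"
  using assms unfolding complex_measure_def signed_measure_def
  by (auto intro!: sums_Re sums_Im sums_minus)

text \<open>
  The supremum that defines the positive part is invariant under a measurable bijection, because the
  bijection maps the measurable subsets of a set onto those of its image.
\<close>

lemma jordan_pos_distr:
  assumes \<nu>: "signed_measure M \<nu>" and h: "h \<in> measurable M M" and h': "h' \<in> measurable M M"
    and inv: "\<And>x. x \<in> space M \<Longrightarrow> h' (h x) = x" "\<And>x. x \<in> space M \<Longrightarrow> h (h' x) = x"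
  shows "jordan_pos M (\<lambda>E. \<nu> (h' ` E)) = distr (jordan_pos M \<nu>) M h"
proof -
  have sp: "h x \<in> space M" "h' x \<in> space M" if "x \<in> space M" for x
    using that h h' by (auto dest: measurable_space)
  have img: "h' ` E = h -` E \<inter> space M" if "E \<subseteq> space M" for E
  proof
    show "h' ` E \<subseteq> h -` E \<inter> space M" using that inv sp by auto
    show "h -` E \<inter> space M \<subseteq> h' ` E" using inv(1) by force
  qed
  have img_sets: "h' ` E \<in> sets M" if "E \<in> sets M" for E
    using measurable_sets [OF h that] img [OF sets.sets_into_space [OF that]] by simp
  have inj: "inj_on h' (space M)" using inv by (metis inj_onI)
  have \<nu>': "signed_measure M (\<lambda>E. \<nu> (h' ` E))"
    unfolding signed_measure_def
  proof (intro conjI allI impI)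
    fix E :: "nat \<Rightarrow> 'a set"
    assume E: "range E \<subseteq> sets M" "disjoint_family E"
    then have sub: "E n \<subseteq> space M" for n using sets.sets_into_space by blast
    have "disjoint_family (\<lambda>n. h' ` E n)"
      using E(2) sub inj unfolding disjoint_family_on_def
      by (metis (no_types, lifting) image_empty inj_on_image_Int)
    then have "(\<lambda>n. \<nu> (h' ` E n)) sums \<nu> (\<Union>n. h' ` E n)"
      using E(1) by (intro signed_measure_sums [OF \<nu>]) (auto intro: img_sets)
    then show "(\<lambda>n. \<nu> (h' ` E n)) sums \<nu> (h' ` (\<Union>n. E n))" by (simp add: image_UN)
  qed (use \<nu> in \<open>simp add: signed_measure_def\<close>)
  show ?thesis
  proof (rule measure_eqI)
    fix E assume "E \<in> sets (jordan_pos M (\<lambda>E. \<nu> (h' ` E)))"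
    then have E: "E \<in> sets M" by simp
    have pre: "h -` E \<inter> space M \<in> sets M" using measurable_sets [OF h E] .
    have "(\<lambda>F. h' ` F) ` {F \<in> sets M. F \<subseteq> E} = {G \<in> sets M. G \<subseteq> h -` E \<inter> space M}"
    proof (intro equalityI subsetI)
      fix G assume "G \<in> (\<lambda>F. h' ` F) ` {F \<in> sets M. F \<subseteq> E}"
      then obtain F where F: "F \<in> sets M" "F \<subseteq> E" "G = h' ` F" by blast
      then show "G \<in> {G \<in> sets M. G \<subseteq> h -` E \<inter> space M}"
        using img_sets [of F] img [OF sets.sets_into_space [of F M]] by auto
    next
      fix G assume G: "G \<in> {G \<in> sets M. G \<subseteq> h -` E \<inter> space M}"
      then have Gs: "G \<subseteq> space M" by auto
      have eq: "h' -` G \<inter> space M = h ` G"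
      proof
        show "h' -` G \<inter> space M \<subseteq> h ` G" using inv(2) by force
        show "h ` G \<subseteq> h' -` G \<inter> space M" using Gs inv(1) sp by auto
      qed
      have "h ` G \<in> sets M" using measurable_sets [OF h', of G] G by (simp add: eq)
      moreover have "h ` G \<subseteq> E" using G by auto
      moreover have "h' ` (h ` G) = G" using Gs inv(1) by (force simp: image_image)
      ultimately show "G \<in> (\<lambda>F. h' ` F) ` {F \<in> sets M. F \<subseteq> E}" by (metis (mono_tags, lifting) imageI mem_Collect_eq)
    qed
    then have "(SUP F\<in>{F \<in> sets M. F \<subseteq> E}. ennreal (\<nu> (h' ` F)))
        = (SUP G\<in>{G \<in> sets M. G \<subseteq> h -` E \<inter> space M}. ennreal (\<nu> G))"
      by (metis (no_types, lifting) SUP_cong image_image)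
    then show "emeasure (jordan_pos M (\<lambda>E. \<nu> (h' ` E))) E = emeasure (distr (jordan_pos M \<nu>) M h) E"
      using h E pre by (simp add: emeasure_distr emeasure_jordan_pos \<nu> \<nu>' measurable_def)
  qed simp
qed

section \<open>Averages of a Fourier transform as Fourier transforms\<close>
lemma space_lebn [simp]: "space (lebn d) = Rn d"
  by (simp add: lebn_def Rn_def space_PiM)

lemma sigma_finite_lebn: "sigma_finite_measure (lebn d)"
proof -
  interpret product_sigma_finite "\<lambda>_::nat. lborel :: real measure"
    by (simp add: product_sigma_finite_def lborel.sigma_finite_measure_axioms)
  show ?thesis unfolding lebn_def by (rule sigma_finite) simp
qed

lemma measurable_coordinate [measurable]: "i < d \<Longrightarrow> (\<lambda>x. x i) \<in> borel_measurable (lebn d)"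
  using measurable_component_singleton [of i "{..<d}" "\<lambda>_. lborel"] by (simp add: lebn_def)

text \<open>
  Continuity refers to the topology of the full function space. The inclusion of \<open>Rn d\<close> into it is
  measurable, since each coordinate is measurable or constant.
\<close>

lemma borel_measurable_if_continuous_on_Rn:
  assumes "continuous_on (Rn d) g"
  shows "g \<in> borel_measurable (lebn d)"
proof -
  have "(\<lambda>x. x i) \<in> borel_measurable (lebn d)" for i
  proof (cases "i < d")
    case False
    have "(\<lambda>x. undefined :: real) \<in> borel_measurable (lebn d)" by simp
    moreover have "x i = undefined" if "x \<in> space (lebn d)" for x
      using that False by (auto simp: Rn_def PiE_def extensional_def)
    ultimately show ?thesis by (subst measurable_cong [where g = "\<lambda>_. undefined"]) auto
  qed (rule measurable_coordinate)
  then have "(\<lambda>x. x) \<in> measurable (lebn d) borel"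
    by (rule measurable_coordinatewise_then_product)
  then have "(\<lambda>x. x) \<in> measurable (lebn d) (restrict_space borel (Rn d))"
    by (intro measurable_restrict_space2) auto
  from measurable_compose [OF this borel_measurable_continuous_on_restrict [OF assms]]
  show ?thesis .
qed

lemma measurable_scalen [measurable]: "scalen d t \<in> measurable (lebn d) (lebn d)"
proof -
  have "(\<lambda>x. \<lambda>i\<in>{..<d}. t * x i) \<in> measurable (lebn d) (PiM {..<d} (\<lambda>_. lborel))"
    by (intro measurable_restrict) (auto intro!: borel_measurable_times measurable_coordinate)
  then show ?thesis by (simp add: scalen_def [abs_def] lebn_def)
qed

lemma measurable_minusn [measurable]: "minusn d x \<in> measurable (lebn d) (lebn d)"
proof -
  have "(\<lambda>y. \<lambda>i\<in>{..<d}. x i - y i) \<in> measurable (lebn d) (PiM {..<d} (\<lambda>_. lborel))"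
    by (intro measurable_restrict) (auto intro!: borel_measurable_diff measurable_coordinate)
  then show ?thesis by (simp add: minusn_def [abs_def] lebn_def)
qed

lemma measurable_dotn [measurable (raw)]:
  assumes f: "f \<in> measurable N (lebn d)" and g: "g \<in> measurable N (lebn d)"
  shows "(\<lambda>w. dotn d (f w) (g w)) \<in> borel_measurable N"
  unfolding dotn_def
  using measurable_compose [OF f measurable_coordinate] measurable_compose [OF g measurable_coordinate]
  by (auto intro!: borel_measurable_sum borel_measurable_times)

abbreviation wave :: "nat \<Rightarrow> (nat \<Rightarrow> real) \<Rightarrow> (nat \<Rightarrow> real) \<Rightarrow> complex" where
  "wave d x y \<equiv> exp (- 2 * of_real pi * \<i> * of_real (dotn d x y))"

lemma norm_wave [simp]: "norm (wave d x y) = 1"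
  by simp

lemma borel_measurable_fourier [measurable]:
  assumes [measurable]: "f \<in> borel_measurable (lebn d)"
  shows "fourier d f \<in> borel_measurable (lebn d)"
proof -
  interpret sigma_finite_measure "lebn d" by (rule sigma_finite_lebn)
  show ?thesis
    unfolding fourier_def [abs_def] by (rule borel_measurable_lebesgue_integral) measurable
qed

lemma integrable_wave_mult:
  assumes "integrable (lebn d) f"
  shows "integrable (lebn d) (\<lambda>x. wave d x y * f x)"
proof (rule Bochner_Integration.integrable_bound [OF assms])
  have [measurable]: "f \<in> borel_measurable (lebn d)" using assms by auto
  show "(\<lambda>x. wave d x y * f x) \<in> borel_measurable (lebn d)"
    unfolding dotn_def by measurable
qed (simp add: norm_mult)

lemma fourier_diff:
  assumes "integrable (lebn d) f" "integrable (lebn d) g"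
  shows "fourier d (\<lambda>x. f x - g x) y = fourier d f y - fourier d g y"
  unfolding fourier_def right_diff_distrib
  by (intro Bochner_Integration.integral_diff integrable_wave_mult assms)

lemma wave_minusn_scalen:
  "wave d z (minusn d x (scalen d t y)) = wave d z x * wave d y (scalen d (- t) z)"
proof -
  have "dotn d z (minusn d x (scalen d t y)) = dotn d z x + dotn d y (scalen d (- t) z)"
    by (simp add: dotn_def minusn_def scalen_def algebra_simps sum.distrib sum_subtractf sum_negf)
  then show ?thesis by (simp add: exp_add [symmetric] algebra_simps)
qed

text \<open>
  Fubini's theorem; the integrand has absolute value \<open>\<bar>f z\<bar>\<close>, so finiteness of \<open>N\<close> suffices. The plane wave
  at \<open>x - t y\<close> splits into the wave at \<open>x\<close> and the wave at \<open>- t z\<close> as a function of \<open>y\<close>.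
\<close>

lemma fourier_average:
  assumes N: "finite_measure N" "sets N = sets (lebn d)" and f: "integrable (lebn d) f"
  shows "integrable (lebn d) (\<lambda>z. wave d z x * (f z * (LINT y|N. wave d y (scalen d (- t) z))))"
    and "(LINT y|N. fourier d f (minusn d x (scalen d t y)))
      = (LINT z|lebn d. wave d z x * (f z * (LINT y|N. wave d y (scalen d (- t) z))))"
proof -
  interpret finite_measure N by fact
  interpret P: pair_sigma_finite "lebn d" N
    by (intro pair_sigma_finite.intro sigma_finite_lebn sigma_finite_measure_axioms)
  note [measurable_cong] = N(2)
  have [measurable]: "f \<in> borel_measurable (lebn d)" using f by auto
  define h where "h z y = wave d z (minusn d x (scalen d t y)) * f z" for z y
  have meas [measurable]: "case_prod h \<in> borel_measurable (lebn d \<Otimes>\<^sub>M N)"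
    unfolding h_def case_prod_beta by measurable
  have norm_h: "norm (h z y) = norm (f z)" for z y by (simp add: h_def norm_mult)
  have hz: "integrable N (h z)" if "z \<in> Rn d" for z
  proof (rule integrable_const_bound [where B = "norm (f z)"])
    show "h z \<in> borel_measurable N" using measurable_Pair2 [OF meas, of z] that by simp
  qed (simp add: norm_h)
  have int: "integrable (lebn d \<Otimes>\<^sub>M N) (case_prod h)"
  proof (rule P.Fubini_integrable [OF meas])
    show "integrable (lebn d) (\<lambda>z. LINT y|N. norm (case_prod h (z, y)))"
      using f by (simp add: norm_h)
  qed (use hz in auto)
  have inner: "(LINT y|N. h z y) = wave d z x * (f z * (LINT y|N. wave d y (scalen d (- t) z)))" for z
    unfolding h_def wave_minusn_scalen
    by (simp only: mult.assoc mult.commute [of _ "f z"] mult.left_commute [of _ "f z"]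
        integral_mult_right_zero)
  show "integrable (lebn d) (\<lambda>z. wave d z x * (f z * (LINT y|N. wave d y (scalen d (- t) z))))"
    using P.integrable_fst [OF int] unfolding inner .
  show "(LINT y|N. fourier d f (minusn d x (scalen d t y)))
      = (LINT z|lebn d. wave d z x * (f z * (LINT y|N. wave d y (scalen d (- t) z))))"
    using P.Fubini_integral [OF int] unfolding inner by (simp add: fourier_def h_def)
qed

lemma jordan_pos_dilate:
  assumes "signed_measure (lebn d) \<nu>" "0 < t"
  shows "jordan_pos (lebn d) (\<lambda>E. \<nu> (scalen d (inverse t) ` E)) = distr (jordan_pos (lebn d) \<nu>) (lebn d) (scalen d t)"
proof (rule jordan_pos_distr [OF assms(1)])
  have "scalen d s (scalen d r x) = x" if "x \<in> Rn d" "s * r = 1" for x s r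
    using that by (auto simp: scalen_def fun_eq_iff Rn_def PiE_def extensional_def mult.assoc [symmetric])
  then show "scalen d (inverse t) (scalen d t x) = x" "scalen d t (scalen d (inverse t) x) = x"
    if "x \<in> space (lebn d)" for x
    using that assms(2) by auto
qed measurable

text \<open>
  Integration against \<open>\<mu>\<close> is a combination of four integrals against finite positive measures. Each one is
  treated by \<open>fourier_average\<close>, after the dilation has been moved from the measure to the integrand.
  The Fourier transform of \<open>\<mu>\<close> is the same combination, so the four terms reassemble.
\<close>

lemma conv_fourier_dilate:
  assumes \<mu>: "complex_measure (lebn d) \<mu>" and f: "integrable (lebn d) f" and t: "0 < t"
  shows "conv d (fourier d f) (dilate d t \<mu>) x = fourier d (\<lambda>z. f z * cm_fourier d \<mu> (scalen d (- t) z)) x"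
proof -
  have [measurable]: "f \<in> borel_measurable (lebn d)" using f by auto
  define a where "a \<nu> z = (LINT y|jordan_pos (lebn d) \<nu>. wave d y (scalen d (- t) z))" for \<nu> z
  define u where "u \<nu> z = wave d z x * (f z * a \<nu> z)" for \<nu> z
  have *: "(LINT y|jordan_pos (lebn d) (\<lambda>E. \<nu> (scalen d (inverse t) ` E)). fourier d f (minusn d x y))
      = (LINT z|lebn d. u \<nu> z)"
    and int: "integrable (lebn d) (u \<nu>)"
    if "signed_measure (lebn d) \<nu>" for \<nu>
  proof -
    have "(LINT y|jordan_pos (lebn d) (\<lambda>E. \<nu> (scalen d (inverse t) ` E)). fourier d f (minusn d x y))
        = (LINT y|jordan_pos (lebn d) \<nu>. fourier d f (minusn d x (scalen d t y)))"
      unfolding jordan_pos_dilate [OF that t] by (subst integral_distr) measurable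
    then show "(LINT y|jordan_pos (lebn d) (\<lambda>E. \<nu> (scalen d (inverse t) ` E)). fourier d f (minusn d x y))
        = (LINT z|lebn d. u \<nu> z)"
      using fourier_average(2) [OF finite_measure_jordan_pos [OF that] sets_jordan_pos f]
      by (simp add: a_def u_def)
    show "integrable (lebn d) (u \<nu>)"
      using fourier_average(1) [OF finite_measure_jordan_pos [OF that] sets_jordan_pos f]
      by (simp add: a_def u_def [abs_def])
  qed
  note S = complex_measure_signed [OF \<mu>]
  note i = int [OF S(1)] int [OF S(2)] int [OF S(3)] int [OF S(4)]
  have eq: "wave d z x * (f z * cm_fourier d \<mu> (scalen d (- t) z))
      = (u (\<lambda>E. Re (\<mu> E)) z - u (\<lambda>E. - Re (\<mu> E)) z) + \<i> * (u (\<lambda>E. Im (\<mu> E)) z - u (\<lambda>E. - Im (\<mu> E)) z)" for z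
    by (simp add: cm_fourier_def cm_integral_def a_def u_def algebra_simps)
  show ?thesis
    unfolding conv_def cm_integral_def dilate_def * [OF S(1)] * [OF S(2)] * [OF S(3)] * [OF S(4)]
      fourier_def [of d "\<lambda>z. f z * cm_fourier d \<mu> (scalen d (- t) z)"] eq
    by (simp add: i)
qed

lemma schwartz_smoothn: "schwartz d f \<Longrightarrow> smoothn d f"
  by (simp add: schwartz_def)

lemma schwartz_decay:
  assumes "schwartz d f"
  obtains B where "\<And>x. x \<in> Rn d \<Longrightarrow> (1 + normn d x) ^ N * norm (f x) \<le> B"
  using assms unfolding schwartz_def by (metis empty_subsetI foldr_Nil id_apply list.set(1))

lemma smoothn_measurable: "smoothn d f \<Longrightarrow> f \<in> borel_measurable (lebn d)"
  by (intro borel_measurable_if_continuous_on_Rn Ck_continuous [of d 0]) (rule smoothn_imp_Ck)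

lemma prod_one_plus_square_le: "(\<Prod>i<d. 1 + (x i)\<^sup>2) \<le> (1 + normn d x) ^ (2 * d)"
proof -
  have "(\<Prod>i<d. 1 + (x i)\<^sup>2) \<le> (\<Prod>i<d. (1 + normn d x)\<^sup>2)"
  proof (rule prod_mono)
    fix i assume i: "i \<in> {..<d}"
    have "\<bar>x i\<bar> \<le> normn d x"
      unfolding normn_def using member_le_L2_set [of "{..<d}" i "\<lambda>i. \<bar>x i\<bar>"] i by (simp add: L2_set_def)
    then have "\<bar>x i\<bar>\<^sup>2 \<le> (normn d x)\<^sup>2" by (intro power_mono) auto
    then show "0 \<le> 1 + (x i)\<^sup>2 \<and> 1 + (x i)\<^sup>2 \<le> (1 + normn d x)\<^sup>2"
      by (simp add: power2_sum add_increasing2)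
  qed
  then show ?thesis by (simp add: power_mult)
qed

text \<open>
  Decay of order \<open>2 d\<close> dominates the product of the integrable functions \<open>1 / (1 + x\<^sub>i\<^sup>2)\<close>.
\<close>

lemma schwartz_integrable:
  assumes f: "schwartz d f"
  shows "integrable (lebn d) f"
proof -
  obtain B where B: "\<And>x. x \<in> Rn d \<Longrightarrow> (1 + normn d x) ^ (2 * d) * norm (f x) \<le> B"
    using schwartz_decay [OF f] by blast
  interpret product_sigma_finite "\<lambda>_::nat. lborel :: real measure"
    by (simp add: product_sigma_finite_def lborel.sigma_finite_measure_axioms)
  have "integrable lborel (\<lambda>x::real. inverse (1 + x\<^sup>2))"
    using integrable_inverse_1_plus_square by (simp add: set_integrable_def)
  then have "integrable (lebn d) (\<lambda>x. \<Prod>i<d. inverse (1 + (x i)\<^sup>2))"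
    unfolding lebn_def by (intro product_integrable_prod) auto
  then have "integrable (lebn d) (\<lambda>x. B * (\<Prod>i<d. inverse (1 + (x i)\<^sup>2)))" by simp
  then show ?thesis
  proof (rule Bochner_Integration.integrable_bound)
    show "f \<in> borel_measurable (lebn d)" by (rule smoothn_measurable [OF schwartz_smoothn [OF f]])
    show "AE x in lebn d. norm (f x) \<le> norm (B * (\<Prod>i<d. inverse (1 + (x i)\<^sup>2)))"
    proof (rule AE_I2)
      fix x assume "x \<in> space (lebn d)"
      then have x: "x \<in> Rn d" by simp
      let ?p = "\<Prod>i<d. 1 + (x i)\<^sup>2"
      have p: "0 < ?p" by (intro prod_pos) (simp add: add_pos_nonneg)
      have "?p * norm (f x) \<le> (1 + normn d x) ^ (2 * d) * norm (f x)"
        by (intro mult_right_mono prod_one_plus_square_le) simp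
      also have "\<dots> \<le> B" by (rule B [OF x])
      finally have "norm (f x) \<le> B / ?p" using p by (simp add: pos_le_divide_eq mult.commute)
      also have "\<dots> = B * (\<Prod>i<d. inverse (1 + (x i)\<^sup>2))"
        by (simp add: divide_inverse prod_inversef [symmetric])
      finally show "norm (f x) \<le> norm (B * (\<Prod>i<d. inverse (1 + (x i)\<^sup>2)))" by simp
    qed
  qed
qed

lemma schwartz_powr_integrable:
  assumes f: "schwartz d f" and p: "1 \<le> p"
  shows "integrable (lebn d) (\<lambda>x. norm (f x) powr p)"
proof -
  have [measurable]: "f \<in> borel_measurable (lebn d)"
    by (rule smoothn_measurable [OF schwartz_smoothn [OF f]])
  obtain B where B: "\<And>x. x \<in> Rn d \<Longrightarrow> norm (f x) \<le> B"
    using schwartz_decay [OF f, of 0] by auto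
  have "integrable (lebn d) (\<lambda>x. B powr (p - 1) * norm (f x))"
    using schwartz_integrable [OF f] by simp
  then show ?thesis
  proof (rule Bochner_Integration.integrable_bound)
    show "AE x in lebn d. norm (norm (f x) powr p) \<le> norm (B powr (p - 1) * norm (f x))"
    proof (rule AE_I2)
      fix x assume "x \<in> space (lebn d)"
      then have "norm (f x) \<le> B" using B by simp
      then have "norm (f x) powr (p - 1) \<le> B powr (p - 1)"
        using p by (intro powr_mono2) auto
      then have "norm (f x) powr (p - 1) * norm (f x) \<le> B powr (p - 1) * norm (f x)"
        by (intro mult_right_mono) auto
      moreover have "norm (f x) powr (p - 1) * norm (f x) = norm (f x) powr p"
        using powr_mult_base [of "norm (f x)" "p - 1"] by (simp add: mult.commute)
      ultimately show "norm (norm (f x) powr p) \<le> norm (B powr (p - 1) * norm (f x))" by simp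
    qed
  qed measurable
qed

section \<open>Extension of the restriction estimate and the variational theorem\<close>
lemma epowr_ennreal: "0 \<le> a \<Longrightarrow> epowr (ennreal a) q = ennreal (a powr q)"
  by (simp add: epowr_def)

lemma epowr_mono: "u \<le> v \<Longrightarrow> 0 \<le> q \<Longrightarrow> epowr u q \<le> epowr v q"
  by (auto simp: epowr_def top_unique less_top intro!: ennreal_leI powr_mono2 enn2real_mono)

lemma epowr_epowr_inverse: "0 < q \<Longrightarrow> epowr (epowr u q) (1 / q) = u"
  by (auto simp: epowr_def powr_powr less_top)

lemma epowr_le_iff:
  assumes "0 < q" "0 \<le> c"
  shows "epowr u (1 / q) \<le> ennreal c \<longleftrightarrow> u \<le> ennreal (c powr q)"
proof
  assume "epowr u (1 / q) \<le> ennreal c"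
  then have "epowr (epowr u (1 / q)) q \<le> epowr (ennreal c) q"
    using assms by (intro epowr_mono) auto
  then show "u \<le> ennreal (c powr q)"
    using epowr_epowr_inverse [of "1 / q" u] assms by (simp add: epowr_ennreal)
next
  assume "u \<le> ennreal (c powr q)"
  then have "epowr u (1 / q) \<le> epowr (ennreal (c powr q)) (1 / q)"
    using assms by (intro epowr_mono) auto
  then show "epowr u (1 / q) \<le> ennreal c"
    using assms by (simp add: epowr_ennreal powr_powr)
qed

lemma Lnorm_le_iff:
  "0 < q \<Longrightarrow> 0 \<le> c \<Longrightarrow> Lnorm q M F \<le> ennreal c \<longleftrightarrow> (\<integral>\<^sup>+x. epowr (F x) q \<partial>M) \<le> ennreal (c powr q)"
  unfolding Lnorm_def by (rule epowr_le_iff)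

lemma Lnorm_norm_eq:
  assumes "integrable M (\<lambda>x. norm (f x) powr p)"
  shows "Lnorm p M (\<lambda>x. ennreal (norm (f x))) = ennreal ((LINT x|M. norm (f x) powr p) powr (1 / p))"
  unfolding Lnorm_def using assms
  by (simp add: epowr_ennreal nn_integral_eq_integral)

text \<open>
  The truncations of \<open>g\<close> by cutoffs are smooth with compact support, hence Schwartz functions; their
  \<open>L\<^sup>p\<close> norms are at most that of \<open>g\<close>, and their Fourier transforms converge pointwise to that of \<open>g\<close> by
  dominated convergence. Fatou's lemma then carries the estimate over to \<open>g\<close>.
\<close>

lemma restriction_estimate_extends:
  assumes p: "1 \<le> p" and q: "0 < q" and C: "0 \<le> C"
    and \<sigma>: "sets \<sigma> = sets (restrict_space (lebn d) S)"
    and restr: "\<And>f. schwartz d f \<Longrightarrow> Lnorm q \<sigma> (\<lambda>x. ennreal (norm (fourier d f x)))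
            \<le> ennreal C * Lnorm p (lebn d) (\<lambda>x. ennreal (norm (f x)))"
    and g: "smoothn d g" "integrable (lebn d) g" "integrable (lebn d) (\<lambda>x. norm (g x) powr p)"
  shows "(\<integral>\<^sup>+y. ennreal (norm (fourier d g y) powr q) \<partial>\<sigma>)
    \<le> ennreal ((C * (LINT x|lebn d. norm (g x) powr p) powr (1 / p)) powr q)"
proof -
  define G where "G n x = of_real (cutoff d (real (Suc n)) x) * g x" for n x
  let ?R = "ennreal ((C * (LINT x|lebn d. norm (g x) powr p) powr (1 / p)) powr q)"
  have [measurable]: "g \<in> borel_measurable (lebn d)" using g(2) by auto
  have cut_meas: "(\<lambda>x. complex_of_real (cutoff d R x)) \<in> borel_measurable (lebn d)" for R
    by (rule borel_measurable_if_continuous_on_Rn, rule Ck_continuous, rule Ck_cutoff [of d 0 R])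
  have G_meas [measurable]: "G n \<in> borel_measurable (lebn d)" for n
    unfolding G_def [abs_def] using cut_meas by (intro borel_measurable_times) auto
  have G_le: "norm (G n x) \<le> norm (g x)" for n x
    using cutoff_bounds [of d "real (Suc n)" x] by (simp add: G_def norm_mult mult_left_le_one_le)
  have G_schwartz: "schwartz d (G n)" for n
  proof (rule schwartz_if_compact_support)
    show "smoothn d (G n)"
      unfolding smoothn_iff_Ck G_def [abs_def]
      by (intro allI Ck_mult Ck_cutoff smoothn_imp_Ck g(1))
    show "G n x = 0" if "\<exists>i<d. real (Suc n) < \<bar>x i\<bar>" for x
      using that by (auto simp: G_def cutoff_eq_0)
  qed
  have bound: "(\<integral>\<^sup>+y. ennreal (norm (fourier d (G n) y) powr q) \<partial>\<sigma>) \<le> ?R" for n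
  proof -
    have int: "integrable (lebn d) (\<lambda>x. norm (G n x) powr p)"
      by (rule schwartz_powr_integrable [OF G_schwartz p])
    have "Lnorm q \<sigma> (\<lambda>x. ennreal (norm (fourier d (G n) x)))
        \<le> ennreal (C * (LINT x|lebn d. norm (G n x) powr p) powr (1 / p))"
      using restr [OF G_schwartz [of n]] C unfolding Lnorm_norm_eq [OF int]
      by (simp add: ennreal_mult)
    also have "\<dots> \<le> ennreal (C * (LINT x|lebn d. norm (g x) powr p) powr (1 / p))"
      using p C by (intro ennreal_leI mult_left_mono powr_mono2 integral_mono [OF int g(3)] G_le) auto
    finally show ?thesis
      using q C by (subst (asm) Lnorm_le_iff) (auto simp: epowr_ennreal)
  qed
  have lim: "(\<lambda>n. fourier d (G n) y) \<longlonglongrightarrow> fourier d g y" for y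
    unfolding fourier_def
  proof (rule integral_dominated_convergence [where w = "\<lambda>x. norm (g x)"])
    show "AE x in lebn d. (\<lambda>n. wave d x y * G n x) \<longlonglongrightarrow> wave d x y * g x"
    proof (rule AE_I2)
      fix x
      have "(\<lambda>n. wave d x y * (complex_of_real (cutoff d (real (Suc n)) x) * g x))
          \<longlonglongrightarrow> wave d x y * (complex_of_real 1 * g x)"
        by (intro tendsto_mult tendsto_const tendsto_of_real cutoff_tendsto_1)
      then show "(\<lambda>n. wave d x y * G n x) \<longlonglongrightarrow> wave d x y * g x" by (simp add: G_def)
    qed
    show "(\<lambda>x. wave d x y * g x) \<in> borel_measurable (lebn d)" 
      using integrable_wave_mult [OF g(2)] by auto
    show "(\<lambda>x. wave d x y * G n x) \<in> borel_measurable (lebn d)" for n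
      using integrable_wave_mult [OF schwartz_integrable [OF G_schwartz]] by auto
  qed (use g(2) G_le in \<open>auto simp: norm_mult\<close>)
  have F_meas: "fourier d (G n) \<in> borel_measurable \<sigma>" for n
    using measurable_restrict_space1 [OF borel_measurable_fourier [OF G_meas]]
    by (simp add: measurable_cong_sets [OF \<sigma> refl])
  have "(\<integral>\<^sup>+y. ennreal (norm (fourier d g y) powr q) \<partial>\<sigma>)
      = (\<integral>\<^sup>+y. liminf (\<lambda>n. ennreal (norm (fourier d (G n) y) powr q)) \<partial>\<sigma>)"
  proof (rule nn_integral_cong)
    fix y
    have "(\<lambda>n. ennreal (norm (fourier d (G n) y) powr q)) \<longlonglongrightarrow> ennreal (norm (fourier d g y) powr q)"
      using q by (intro tendsto_ennrealI tendsto_powr' tendsto_norm lim tendsto_const) auto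
    then show "ennreal (norm (fourier d g y) powr q) = liminf (\<lambda>n. ennreal (norm (fourier d (G n) y) powr q))"
      by (rule lim_imp_Liminf [OF sequentially_bot, symmetric])
  qed
  also have "\<dots> \<le> liminf (\<lambda>n. \<integral>\<^sup>+y. ennreal (norm (fourier d (G n) y) powr q) \<partial>\<sigma>)"
  proof (rule nn_integral_liminf)
    have "(\<lambda>w::complex. ennreal (norm w powr q)) \<in> borel_measurable borel" by measurable
    then show "(\<lambda>y. ennreal (norm (fourier d (G n) y) powr q)) \<in> borel_measurable \<sigma>" for n
      by (rule measurable_compose [OF F_meas])
  qed
  also have "\<dots> \<le> liminf (\<lambda>n. ?R)"
    by (intro Liminf_mono always_eventually allI bound)
  finally show ?thesis by (simp add: Liminf_const)
qed

text \<open>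
  For \<open>p \<ge> 1\<close> the power function is superadditive on nonnegative numbers. This is where the exponent \<open>p\<close> of the
  restriction estimate turns increments of the multiplier into increments of a single increasing function.
\<close>

lemma powr_diff_le_diff_powr:
  fixes a b p :: real
  assumes "0 \<le> a" "a \<le> b" "1 \<le> p"
  shows "(b - a) powr p \<le> b powr p - a powr p"
proof -
  have split: "x powr p = x * x powr (p - 1)" if "0 \<le> x" for x
    using powr_mult_base [OF that, of "p - 1"] by simp
  have "(b - a) powr p + a powr p = (b - a) * (b - a) powr (p - 1) + a * a powr (p - 1)"
    using assms by (simp add: split)
  also have "\<dots> \<le> (b - a) * b powr (p - 1) + a * b powr (p - 1)"
    using assms by (intro add_mono mult_left_mono powr_mono2) auto
  also have "\<dots> = b powr p" using assms by (simp add: split algebra_simps)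
  finally show ?thesis by simp
qed

lemma radial_profile_tendsto:
  assumes "u \<longlonglongrightarrow> t" "0 \<le> t"
  shows "(\<lambda>n. radial_profile d \<eta> (u n) z) \<longlonglongrightarrow> radial_profile d \<eta> t z"
proof -
  have "1 + t * normn d z \<noteq> 0" using assms(2) by (smt (verit) mult_nonneg_nonneg normn_nonneg)
  then show ?thesis
    unfolding radial_profile_def
    by (intro tendsto_diff tendsto_const tendsto_powr tendsto_add tendsto_mult assms(1))
qed

lemma borel_measurable_radial_profile [measurable]: "radial_profile d \<eta> t \<in> borel_measurable (lebn d)"
proof -
  have [measurable]: "normn d \<in> borel_measurable (lebn d)"
    by (rule borel_measurable_if_continuous_on_Rn [OF continuous_on_normn])
  show ?thesis unfolding radial_profile_def [abs_def] by measurable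
qed

text \<open>
  The function \<open>t \<mapsto> \<integral> G (a t)\<^sup>p\<close> is the control function of the path, with \<open>G = \<bar>f\<bar>\<^sup>p\<close>. Its properties follow from
  \<open>0 \<le> a t \<le> 1\<close> and dominated convergence.
\<close>

lemma radial_mass:
  assumes G: "integrable (lebn d) G" and "\<And>z. 0 \<le> G z" and \<eta>: "0 < \<eta>" and p: "0 < p"
  shows "0 \<le> t \<Longrightarrow> integrable (lebn d) (\<lambda>z. G z * radial_profile d \<eta> t z powr p)"
    and "continuous_on {0..} (\<lambda>t. LINT z|lebn d. G z * radial_profile d \<eta> t z powr p)"
    and "0 \<le> t \<Longrightarrow> (LINT z|lebn d. G z * radial_profile d \<eta> t z powr p) \<le> (LINT z|lebn d. G z)"
proof -
  have [measurable]: "G \<in> borel_measurable (lebn d)" using G by auto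
  have le: "G z * radial_profile d \<eta> t z powr p \<le> G z" if "0 \<le> t" for t z
    using radial_profile_bounds [OF \<eta> that, of d z] assms(2) p
    by (intro mult_right_le_one_le) (auto intro: powr_le1)
  show int: "integrable (lebn d) (\<lambda>z. G z * radial_profile d \<eta> t z powr p)" if "0 \<le> t" for t
    by (rule Bochner_Integration.integrable_bound [OF G]) (use le [OF that] assms(2) in auto)
  show "(LINT z|lebn d. G z * radial_profile d \<eta> t z powr p) \<le> (LINT z|lebn d. G z)" if "0 \<le> t" for t
    by (rule integral_mono [OF int [OF that] G le [OF that]])
  show "continuous_on {0..} (\<lambda>t. LINT z|lebn d. G z * radial_profile d \<eta> t z powr p)"
  proof (rule continuous_on_sequentiallyI)
    fix u :: "nat \<Rightarrow> real" and t
    assume u: "\<forall>n. u n \<in> {0..}" "t \<in> {0..}" "u \<longlonglongrightarrow> t"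
    show "(\<lambda>n. LINT z|lebn d. G z * radial_profile d \<eta> (u n) z powr p)
        \<longlonglongrightarrow> (LINT z|lebn d. G z * radial_profile d \<eta> t z powr p)"
    proof (rule integral_dominated_convergence [OF _ _ G])
      show "AE z in lebn d. (\<lambda>n. G z * radial_profile d \<eta> (u n) z powr p) \<longlonglongrightarrow> G z * radial_profile d \<eta> t z powr p"
      proof (intro AE_I2 tendsto_mult tendsto_const tendsto_powr' conjI disjI2 radial_profile_tendsto u)
        show "\<forall>\<^sub>F n in sequentially. 0 \<le> radial_profile d \<eta> (u n) z" for z
          using u(1) radial_profile_bounds(1) [OF \<eta>] by simp
      qed (use u p in auto)
    qed (use u le assms(2) in auto)
  qed
qed

lemma epowr_Sup_le:
  assumes q: "0 < q" and "\<And>v. v \<in> V \<Longrightarrow> 0 \<le> f v \<and> ennreal (f v powr q) \<le> h"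
  shows "epowr (SUP v\<in>V. ennreal (f v)) q \<le> h"
proof (cases h)
  case (real w)
  have "f v \<le> w powr (1 / q)" if "v \<in> V" for v
  proof -
    have "f v powr q \<le> w" using assms(2) [OF that] real by simp
    then have "(f v powr q) powr (1 / q) \<le> w powr (1 / q)" using q by (intro powr_mono2) auto
    then show ?thesis using q assms(2) [OF that] by (simp add: powr_powr)
  qed
  then have "(SUP v\<in>V. ennreal (f v)) \<le> ennreal (w powr (1 / q))"
    by (intro SUP_least ennreal_leI)
  then have "epowr (SUP v\<in>V. ennreal (f v)) q \<le> epowr (ennreal (w powr (1 / q))) q"
    using q by (intro epowr_mono) auto
  then show ?thesis using q real by (simp add: epowr_ennreal powr_powr)
qed simp

theorem theorem4:
  fixes p q \<rho> \<eta> :: real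
  assumes "1 \<le> p" "p \<le> 2" "1 < q" "p < q" "p < \<rho>" "0 < \<eta>"
  shows "\<exists>A::real. 0 \<le> A \<and>
    (\<forall>(d::nat) (S :: (nat \<Rightarrow> real) set) (\<sigma> :: (nat \<Rightarrow> real) measure)
      (\<mu> :: (nat \<Rightarrow> real) set \<Rightarrow> complex) (D::real) (C::real).
       1 \<le> d \<longrightarrow>
       S \<in> sets (lebn d) \<longrightarrow>
       space \<sigma> = S \<longrightarrow> sets \<sigma> = sets (restrict_space (lebn d) S) \<longrightarrow>
       complex_measure (lebn d) \<mu> \<longrightarrow>
       smoothn d (cm_fourier d \<mu>) \<longrightarrow>
       0 \<le> D \<longrightarrow>
       (\<forall>x\<in>Rn d. grad_norm d (cm_fourier d \<mu>) x \<le> D * (1 + normn d x) powr (- 1 - \<eta>)) \<longrightarrow>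
       0 \<le> C \<longrightarrow>
       (\<forall>f. schwartz d f \<longrightarrow>
          Lnorm q \<sigma> (\<lambda>x. ennreal (norm (fourier d f x)))
            \<le> ennreal C * Lnorm p (lebn d) (\<lambda>x. ennreal (norm (f x)))) \<longrightarrow>
       (\<forall>f. schwartz d f \<longrightarrow>
          Lnorm q \<sigma> (variation d \<rho> \<mu> (fourier d f))
            \<le> ennreal (A * C * D) * Lnorm p (lebn d) (\<lambda>x. ennreal (norm (f x)))))"
proof -
  define r where "r = (p + min q \<rho>) / 2"
  have r: "p < r" "r < q" "r \<le> \<rho>" using assms by (auto simp: r_def min_def)
  define A where "A = variation_const p q r / \<eta>"
  have A: "0 \<le> A" using assms(6) by (simp add: A_def variation_const_nonneg)
  have "Lnorm q \<sigma> (variation d \<rho> \<mu> (fourier d f))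
      \<le> ennreal (A * C * D) * Lnorm p (lebn d) (\<lambda>x. ennreal (norm (f x)))"
    if S: "S \<in> sets (lebn d)" "space \<sigma> = S"
      and \<sigma>: "sets \<sigma> = sets (restrict_space (lebn d) S)"
      and \<mu>: "complex_measure (lebn d) \<mu>" and smooth: "smoothn d (cm_fourier d \<mu>)"
      and D: "0 \<le> D"
      and grad: "\<forall>x\<in>Rn d. grad_norm d (cm_fourier d \<mu>) x \<le> D * (1 + normn d x) powr (- 1 - \<eta>)"
      and C: "0 \<le> C"
      and restr: "\<forall>f. schwartz d f \<longrightarrow>
          Lnorm q \<sigma> (\<lambda>x. ennreal (norm (fourier d f x)))
            \<le> ennreal C * Lnorm p (lebn d) (\<lambda>x. ennreal (norm (f x)))"
      and f: "schwartz d f"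
    for d :: nat and S \<sigma> \<mu> D C f
  proof -
    let ?a = "radial_profile d \<eta>"
    \<comment> \<open>The path starts at \<open>t = 0\<close>, where its multiplier does not depend on \<open>z\<close>.\<close>
    define m where "m t z = cm_fourier d \<mu> (scalen d (- t) z)" for t z
    define F where "F t = fourier d (\<lambda>z. f z * m t z)" for t
    define K where "K = C * (D / \<eta>)"
    have K: "0 \<le> K" using C D assms(6) by (simp add: K_def)
    have f_int: "integrable (lebn d) f" by (rule schwartz_integrable [OF f])
    have f_powr: "integrable (lebn d) (\<lambda>z. norm (f z) powr p)"
      by (rule schwartz_powr_integrable [OF f assms(1)])
    have [measurable]: "f \<in> borel_measurable (lebn d)" using f_int by auto
    define I where "I = (LINT z|lebn d. norm (f z) powr p)"
    have I: "0 \<le> I" by (simp add: I_def)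
    have m_smooth: "smoothn d (m t)" for t
      unfolding smoothn_iff_Ck m_def [abs_def] by (intro allI Ck_scalen smoothn_imp_Ck smooth)
    have m_le: "norm (m t z - m s z) \<le> D / \<eta> * (?a t z - ?a s z)" if "0 \<le> s" "s \<le> t" for s t z
      unfolding m_def
      by (rule radial_increment_le [OF smoothn_imp_Ck [OF smooth] D assms(6) _ that]) (use grad in blast)
    have m_abs: "norm (m t z - m s z) \<le> D / \<eta> * \<bar>?a t z - ?a s z\<bar>" if "0 \<le> s" "0 \<le> t" for s t z
    proof (cases "s \<le> t")
      case True
      then show ?thesis using m_le [of s t z] radial_profile_mono [OF assms(6), of s t d z] that by simp
    next
      case False
      then show ?thesis
        using m_le [of t s z] radial_profile_mono [OF assms(6), of t s d z] that
        by (simp add: norm_minus_commute)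
    qed
    define c where "c = norm (cm_fourier d \<mu> (\<lambda>i\<in>{..<d}. 0)) + D / \<eta>"
    have m_bound: "norm (m t z) \<le> c" if "0 \<le> t" for t z
    proof -
      have "scalen d (- 0) z = (\<lambda>i\<in>{..<d}. 0)" by (simp add: scalen_def)
      then have "m 0 z = cm_fourier d \<mu> (\<lambda>i\<in>{..<d}. 0)" by (simp add: m_def)
      moreover have "norm (m t z - m 0 z) \<le> D / \<eta>"
      proof -
        have "D / \<eta> * (?a t z - ?a 0 z) \<le> D / \<eta>"
          using radial_profile_bounds(2) [OF assms(6) that, of d z] D assms(6)
          by (intro mult_left_le) auto
        then show ?thesis using m_le [OF order_refl that, of z] by linarith
      qed
      ultimately show ?thesis
        using norm_triangle_ineq2 [of "m t z" "m 0 z"] by (simp add: c_def)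
    qed
    have m_meas [measurable]: "m t \<in> borel_measurable (lebn d)" for t
      by (rule smoothn_measurable [OF m_smooth])
    have fm_int: "integrable (lebn d) (\<lambda>z. f z * m t z)" if "0 \<le> t" for t
    proof (rule Bochner_Integration.integrable_bound)
      show "integrable (lebn d) (\<lambda>z. c * norm (f z))" using f_int by simp
      show "AE z in lebn d. norm (f z * m t z) \<le> norm (c * norm (f z))"
        using m_bound [OF that]
        by (intro AE_I2) (auto simp: norm_mult abs_mult mult.commute [of c] intro!: mult_left_mono order_trans [OF _ abs_ge_self])
    qed measurable
    have conv: "conv d (fourier d f) (dilate d t \<mu>) x = F t x" if "0 < t" for t x
      unfolding F_def m_def by (rule conv_fourier_dilate [OF \<mu> f_int that])
    have F_meas: "F t \<in> borel_measurable \<sigma>" for t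
    proof -
      have "F t \<in> borel_measurable (lebn d)" unfolding F_def by measurable
      from measurable_restrict_space1 [OF this] show ?thesis
        by (simp add: measurable_cong_sets [OF \<sigma> refl])
    qed
    have F_cont: "continuous_on {0..} (\<lambda>t. F t x)" for x
    proof (rule continuous_on_sequentiallyI)
      fix u :: "nat \<Rightarrow> real" and t
      assume u: "\<forall>n. u n \<in> {0..}" "t \<in> {0..}" "u \<longlonglongrightarrow> t"
      have m_lim: "(\<lambda>n. m (u n) z) \<longlonglongrightarrow> m t z" for z
      proof (rule Lim_transform_bound [THEN Lim_null [THEN iffD2]])
        show "\<forall>\<^sub>F n in sequentially. norm (m (u n) z - m t z) \<le> norm (D / \<eta> * \<bar>?a (u n) z - ?a t z\<bar>)"
          using u D assms(6) by (intro always_eventually allI order_trans [OF m_abs]) auto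
        have "(\<lambda>n. D / \<eta> * \<bar>?a (u n) z - ?a t z\<bar>) \<longlonglongrightarrow> D / \<eta> * \<bar>?a t z - ?a t z\<bar>"
          using u by (intro tendsto_mult tendsto_const tendsto_rabs tendsto_diff radial_profile_tendsto) auto
        then show "(\<lambda>n. D / \<eta> * \<bar>?a (u n) z - ?a t z\<bar>) \<longlonglongrightarrow> 0" by simp
      qed
      show "(\<lambda>n. F (u n) x) \<longlonglongrightarrow> F t x"
        unfolding F_def fourier_def
      proof (rule integral_dominated_convergence [where w = "\<lambda>z. c * norm (f z)"])
        show "AE z in lebn d. (\<lambda>n. wave d z x * (f z * m (u n) z)) \<longlonglongrightarrow> wave d z x * (f z * m t z)"
          by (intro AE_I2 tendsto_mult tendsto_const m_lim)
        show "AE z in lebn d. norm (wave d z x * (f z * m (u n) z)) \<le> c * norm (f z)" for n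
          using u(1) by (intro AE_I2) (auto simp: norm_mult mult.commute [of c] intro!: mult_left_mono m_bound)
        show "integrable (lebn d) (\<lambda>z. c * norm (f z))" using f_int by simp
        show "(\<lambda>z. wave d z x * (f z * m t z)) \<in> borel_measurable (lebn d)"
          using integrable_wave_mult [OF fm_int [of t]] u(2) by auto
        show "(\<lambda>z. wave d z x * (f z * m (u n) z)) \<in> borel_measurable (lebn d)" for n
          using integrable_wave_mult [OF fm_int [of "u n"]] u(1) by auto
      qed
    qed
    define \<Lambda>0 where "\<Lambda>0 t = (LINT z|lebn d. norm (f z) powr p * ?a t z powr p)" for t
    have p: "0 < p" using assms(1) by simp
    note mass = radial_mass [OF f_powr powr_ge_zero assms(6) p]
    have F_incr: "(\<integral>\<^sup>+x. ennreal (norm (F t x - F s x) powr q) \<partial>\<sigma>)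
        \<le> ennreal ((K * (\<Lambda>0 t - \<Lambda>0 s) powr (1 / p)) powr q) \<and> \<Lambda>0 s \<le> \<Lambda>0 t" if st: "0 \<le> s" "s \<le> t" for s t
    proof -
      have t: "0 \<le> t" using st by simp
      define g where "g z = f z * m t z - f z * m s z" for z
      have g_int: "integrable (lebn d) g"
        unfolding g_def using fm_int st t by (intro Bochner_Integration.integrable_diff) auto
      have g_smooth: "smoothn d g"
        unfolding g_def [abs_def] diff_conv_add_uminus smoothn_iff_Ck mult_minus_right [symmetric]
          mult_minus1 [of "m s _", symmetric]
        by (intro allI Ck_add Ck_mult Ck_const smoothn_imp_Ck m_smooth schwartz_smoothn [OF f])
      have [measurable]: "g \<in> borel_measurable (lebn d)" using g_int by auto
      let ?w = "\<lambda>z. (D / \<eta>) powr p * (norm (f z) powr p * ?a t z powr p - norm (f z) powr p * ?a s z powr p)"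
      have w_int: "integrable (lebn d) ?w"
        using mass(1) st t by (intro integrable_mult_right Bochner_Integration.integrable_diff) auto
      have g_le: "norm (g z) powr p \<le> ?w z" for z
      proof -
        have a: "0 \<le> ?a s z" "?a s z \<le> ?a t z"
          using radial_profile_bounds(1) [OF assms(6)] radial_profile_mono [OF assms(6)] st by auto
        have "norm (g z) = norm (f z) * norm (m t z - m s z)"
          by (simp add: g_def flip: right_diff_distrib norm_mult)
        also have "\<dots> \<le> norm (f z) * (D / \<eta> * (?a t z - ?a s z))"
          using m_le [OF st] by (intro mult_left_mono) auto
        finally have "norm (g z) powr p \<le> (norm (f z) * (D / \<eta> * (?a t z - ?a s z))) powr p"
          using p by (intro powr_mono2) auto
        also have "\<dots> = (D / \<eta>) powr p * (norm (f z) powr p * (?a t z - ?a s z) powr p)"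
          by (simp only: powr_mult mult_ac)
        also have "\<dots> \<le> (D / \<eta>) powr p * (norm (f z) powr p * (?a t z powr p - ?a s z powr p))"
          using a assms(1) by (intro mult_left_mono powr_diff_le_diff_powr) auto
        finally show ?thesis by (simp add: right_diff_distrib)
      qed
      have g_powr: "integrable (lebn d) (\<lambda>z. norm (g z) powr p)"
        by (rule Bochner_Integration.integrable_bound [OF w_int])
          (use g_le in \<open>auto intro: order_trans [OF _ abs_ge_self]\<close>)
      have "(LINT z|lebn d. norm (g z) powr p) \<le> (LINT z|lebn d. ?w z)"
        by (rule integral_mono [OF g_powr w_int g_le])
      also have "\<dots> = (D / \<eta>) powr p * (\<Lambda>0 t - \<Lambda>0 s)"
        unfolding \<Lambda>0_def using mass(1) st t by simp
      finally have g_norm: "(LINT z|lebn d. norm (g z) powr p) \<le> (D / \<eta>) powr p * (\<Lambda>0 t - \<Lambda>0 s)" .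
      have mono: "\<Lambda>0 s \<le> \<Lambda>0 t"
        unfolding \<Lambda>0_def
      proof (rule integral_mono [OF mass(1) [OF st(1)] mass(1) [OF t]])
        show "norm (f z) powr p * ?a s z powr p \<le> norm (f z) powr p * ?a t z powr p" for z
          using radial_profile_bounds(1) [OF assms(6) st(1)] radial_profile_mono [OF assms(6) st] p
          by (intro mult_left_mono powr_mono2) auto
      qed
      have "F t x - F s x = fourier d g x" for x
        unfolding F_def g_def using fm_int st t by (subst fourier_diff) auto
      then have "(\<integral>\<^sup>+x. ennreal (norm (F t x - F s x) powr q) \<partial>\<sigma>)
          \<le> ennreal ((C * (LINT z|lebn d. norm (g z) powr p) powr (1 / p)) powr q)"
        using restriction_estimate_extends [OF assms(1) _ C \<sigma> _ g_smooth g_int g_powr, of q] restr assms(3)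
        by simp
      also have "\<dots> \<le> ennreal ((K * (\<Lambda>0 t - \<Lambda>0 s) powr (1 / p)) powr q)"
      proof (rule ennreal_leI, rule powr_mono2)
        have "(LINT z|lebn d. norm (g z) powr p) powr (1 / p) \<le> ((D / \<eta>) powr p * (\<Lambda>0 t - \<Lambda>0 s)) powr (1 / p)"
          using g_norm p by (intro powr_mono2) auto
        also have "\<dots> = D / \<eta> * (\<Lambda>0 t - \<Lambda>0 s) powr (1 / p)"
          using p D assms(6) by (simp add: powr_mult powr_powr del: powr_divide)
        finally show "C * (LINT z|lebn d. norm (g z) powr p) powr (1 / p) \<le> K * (\<Lambda>0 t - \<Lambda>0 s) powr (1 / p)"
          unfolding K_def mult.assoc by (rule mult_left_mono [OF _ C])
      qed (use assms C in auto)
      finally show ?thesis using mono by simp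
    qed
    have main: "Lnorm q \<sigma> (variation d \<rho> \<mu> (fourier d f))
        \<le> ennreal (variation_const p q r * K * (I + \<epsilon>) powr (1 / p))" if \<epsilon>: "0 < \<epsilon>" for \<epsilon>
    proof -
      \<comment> \<open>The small summand makes the control function strictly increasing, even if \<open>f\<close> is zero almost everywhere.\<close>
      define \<Lambda> where "\<Lambda> t = \<Lambda>0 t + \<epsilon> * (t / (1 + t))" for t
      have frac: "s / (1 + s) < t / (1 + t)" if "0 \<le> s" "s < t" for s t :: real
        using that by (simp add: divide_simps algebra_simps)
      obtain H :: "(nat \<Rightarrow> real) \<Rightarrow> ennreal" where
        H: "\<And>x (m::nat) t. x \<in> space \<sigma> \<Longrightarrow> 0 < t 0 \<Longrightarrow> (\<And>j. j < m \<Longrightarrow> t j < t (Suc j)) \<Longrightarrow>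
           ennreal (((\<Sum>j = 1..m. norm (F (t j) x - F (t (j - 1)) x) powr \<rho>) powr (1 / \<rho>)) powr q) \<le> H x"
        and H_int: "(\<integral>\<^sup>+x. H x \<partial>\<sigma>) \<le> ennreal ((variation_const p q r * K * (I + \<epsilon>) powr (1 / p)) powr q)"
      proof (rule variation_bound_of_increments [OF p r, of F \<sigma> \<Lambda> "I + \<epsilon>" K])
        show "continuous_on {0..} \<Lambda>"
          unfolding \<Lambda>_def \<Lambda>0_def by (intro continuous_intros mass(2)) auto
        show "\<Lambda> 0 = 0" using p by (simp add: \<Lambda>_def \<Lambda>0_def)
        show "\<Lambda> s < \<Lambda> t" if "0 \<le> s" "s < t" for s t
          unfolding \<Lambda>_def using F_incr [of s t] frac [OF that] \<epsilon> that
          by (intro add_le_less_mono mult_strict_left_mono) auto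
        show "\<Lambda> t \<le> I + \<epsilon>" if "0 \<le> t" for t
        proof -
          have "t / (1 + t) \<le> 1" using that by simp
          then show ?thesis
            unfolding \<Lambda>_def \<Lambda>0_def I_def using \<epsilon> that
            by (intro add_mono mass(3) mult_left_le) auto
        qed
        show "(\<integral>\<^sup>+x. ennreal (norm (F t x - F s x) powr q) \<partial>\<sigma>)
            \<le> ennreal ((K * (\<Lambda> t - \<Lambda> s) powr (1 / p)) powr q)" if st: "0 \<le> s" "s < t" for s t
        proof -
          have i: "(\<integral>\<^sup>+x. ennreal (norm (F t x - F s x) powr q) \<partial>\<sigma>)
              \<le> ennreal ((K * (\<Lambda>0 t - \<Lambda>0 s) powr (1 / p)) powr q)" "\<Lambda>0 s \<le> \<Lambda>0 t"
            using F_incr [of s t] st by auto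
          have "\<epsilon> * (s / (1 + s)) \<le> \<epsilon> * (t / (1 + t))"
            using frac [OF st] \<epsilon> by (intro mult_left_mono) auto
          then have "\<Lambda>0 t - \<Lambda>0 s \<le> \<Lambda> t - \<Lambda> s" unfolding \<Lambda>_def by linarith
          then have "(K * (\<Lambda>0 t - \<Lambda>0 s) powr (1 / p)) powr q \<le> (K * (\<Lambda> t - \<Lambda> s) powr (1 / p)) powr q"
            using i(2) K p assms(3) by (intro powr_mono2 mult_left_mono) auto
          then show ?thesis using i(1) by (meson ennreal_leI order_trans)
        qed
      qed (use F_meas F_cont K in auto)
      have "epowr (variation d \<rho> \<mu> (fourier d f) x) q \<le> H x" if x: "x \<in> space \<sigma>" for x
        unfolding variation_def case_prod_beta
      proof (rule epowr_Sup_le)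
        fix v :: "nat \<times> (nat \<Rightarrow> real)"
        assume "v \<in> {v. 1 \<le> fst v \<and> 0 < snd v 0 \<and> (\<forall>j<fst v. snd v j < snd v (Suc j))}"
        then obtain m t where v: "v = (m, t)" "0 < t 0" "\<And>j. j < m \<Longrightarrow> t j < t (Suc j)"
          by (cases v) auto
        have pos: "0 < t j" if "j \<le> m" for j
          using that v by (induction j) (auto intro: less_trans)
        have "(\<Sum>j = 1..fst v. norm (conv d (fourier d f) (dilate d (snd v j) \<mu>) x
              - conv d (fourier d f) (dilate d (snd v (j - 1)) \<mu>) x) powr \<rho>)
            = (\<Sum>j = 1..m. norm (F (t j) x - F (t (j - 1)) x) powr \<rho>)"
          unfolding v(1) fst_conv snd_conv
        proof (rule sum.cong [OF refl])
          fix j assume "j \<in> {1..m}"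
          then have "0 < t j" "0 < t (j - 1)" by (auto intro: pos)
          then show "norm (conv d (fourier d f) (dilate d (t j) \<mu>) x
              - conv d (fourier d f) (dilate d (t (j - 1)) \<mu>) x) powr \<rho>
            = norm (F (t j) x - F (t (j - 1)) x) powr \<rho>"
            by (simp only: conv)
        qed
        then show "0 \<le> (\<Sum>j = 1..fst v. norm (conv d (fourier d f) (dilate d (snd v j) \<mu>) x
              - conv d (fourier d f) (dilate d (snd v (j - 1)) \<mu>) x) powr \<rho>) powr (1 / \<rho>) \<and>
            ennreal (((\<Sum>j = 1..fst v. norm (conv d (fourier d f) (dilate d (snd v j) \<mu>) x
              - conv d (fourier d f) (dilate d (snd v (j - 1)) \<mu>) x) powr \<rho>) powr (1 / \<rho>)) powr q) \<le> H x"
          using H [OF x v(2,3)] by simp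
      qed (use assms in simp)
      then have "(\<integral>\<^sup>+x. epowr (variation d \<rho> \<mu> (fourier d f) x) q \<partial>\<sigma>)
          \<le> ennreal ((variation_const p q r * K * (I + \<epsilon>) powr (1 / p)) powr q)"
        by (rule order_trans [OF nn_integral_mono H_int])
      then show ?thesis
        using assms(3) K by (subst Lnorm_le_iff) (auto simp: variation_const_nonneg)
    qed
    have "(\<lambda>n. ennreal (variation_const p q r * K * (I + inverse (real (Suc n))) powr (1 / p)))
        \<longlonglongrightarrow> ennreal (variation_const p q r * K * (I + 0) powr (1 / p))"
      using p by (intro tendsto_ennrealI tendsto_mult tendsto_const tendsto_powr' tendsto_add
          LIMSEQ_inverse_real_of_nat) auto
    then have "Lnorm q \<sigma> (variation d \<rho> \<mu> (fourier d f))
        \<le> ennreal (variation_const p q r * K * (I + 0) powr (1 / p))"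
      by (rule LIMSEQ_le_const) (use main in auto)
    also have "\<dots> = ennreal (A * C * D) * ennreal (I powr (1 / p))"
    proof -
      have eq: "variation_const p q r * K * (I + 0) powr (1 / p) = A * C * D * I powr (1 / p)"
        by (simp add: K_def A_def)
      show ?thesis unfolding eq by (rule ennreal_mult) (use A C D in auto)
    qed
    also have "ennreal (I powr (1 / p)) = Lnorm p (lebn d) (\<lambda>x. ennreal (norm (f x)))"
      unfolding I_def by (rule Lnorm_norm_eq [OF f_powr, symmetric])
    finally show ?thesis .
  qed
  with A show ?thesis by blast
qed

end
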